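(* Let $\mathcal M$ be a model on the countable index set $I$ satisfying acyclicity and finite past, with a fixed viewport, and let $(\psi,Y)$ be a structured query, $\psi:\mathcal G\hookrightarrow I$ (single-level case). Put $L:=N_{\rm inner}\setminus Y$. If there is a regular functional $F$ computing $\mu(\mathcal G,L)=F[\mu_1,\dots,\mu_n]$ with $\mu_1,\dots,\mu_n$ all identifiable, then the underlying query $q(\psi,Y)$ is identifiable.
   Context: **Kernels.** All measurable spaces are standard Borel (Polish spaces with Borel $\sigma$-algebra). A probability kernel from $S$ to $T$ is a measurable map $s\mapsto\mu_s$ from $S$ to the probability measures on $T$ (probability measures are kernels from a one-point space). For $\mu$ from $S$ to $T$ and $\nu$ from $S\times T$ to $U$, $(\mu\otimes\nu)_s(B)=\int\mu_s(dt)\int\nu_{s,t}(du)\,1_B(t,u)$. A kernel is also regarded as a kernel with additional arguments on which it depends trivially. Transposition = reordering the factors of a target product. $\mathrm{marg}_L$ of a kernel into a product is its image under the projection forgetting the factors in $L$. A functional of finitely many kernels is *regular* if it is the identity, a projection to one of its arguments, or a finite combination of $\otimes$-products, right marginalizations ($\mu\otimes\nu\mapsto\mu$), left disintegrations ($\mu\otimes\nu\mapsto\nu$) and transpositions. Conventions: disintegrations are only almost-everywhere unique and kernels are considered equal if they agree almost everywhere; it is a standing assumption that a disintegration $\nu_x$ of a joint $\mu\otimes\nu_x$ is only used in products $\xi\otimes\nu_x$ with $\xi\ll\mu$. **Structured kernels.** A structural graph has a finite node set $N=N_{\rm inner}\sqcup N_{\rm outer}$ and directed edges from nodes in $N$ to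 nodes in $N_{\rm inner}$. It is model-aligned if it is acyclic and each inner node $n$ carries a probability kernel $\mu^n$ with $\kappa$ arguments and a bijection $\mathrm{pa}^n:\{1,\dots,\kappa\}\to\mathrm{Pa}(n)$, value spaces of parents being subspaces of the corresponding factor of the domain of their children. For $L\subset N_{\rm inner}$, $\mu(\mathcal G,L)$ is $\mathrm{marg}_L$ of the product of all $\mu^n$, $n\in N_{\rm inner}$, taken in a causal (topological) order, where the $k$-th argument of $\mu^n$ is the value of node $\mathrm{pa}^n(k)$; values of outer nodes remain as arguments of $\mu(\mathcal G,L)$. It is independent of the order up to transposition. **Model.** Fix a countable set $I$, standard Borel spaces $X_i$ ($i\in I$), and a group $\mathbb G$ acting effectively on $I$; a symmetry is a subgroup $H\subset\mathbb G$. A mechanism is a probability kernel $f$ from $\prod_{k=1}^{\kappa}X^{(k)}$ to $Y'$ together with a subset $J\subset I$, a symmetry $H$ acting freely and transitively on $J$, and an $H$-equivariant map $\mathrm{Pa}=(\mathrm{Pa}^{(1)},\dots,\mathrm{Pa}^{(\kappa)}):J\to I^{\kappa}$ such that $\mathrm{Pa}^{(k)}(j)\ne j$, $\mathrm{Pa}^{(k)}(j)\ne\mathrm{Pa}^{(k')}(j)$ for $k\neq k'$, $Y'\subset X_j$ and $X_{\mathrm{Pa}^{(k)}(j)}\subset X^{(k)}$ for all $j\in J$. A model is a collection of mechanisms $(f_J,J,H_J,\mathrm{Pa}_J)$ whose regions $J$ partition $I$; some mechanisms are known a priori (the set $\mathcal F_{\rm intervene}=\theta$), the others unknown. $J(i)$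 is the region containing $i$. The $I$-graph has nodes $I$ and an edge $i\to i'$ iff $i\in\mathrm{Pa}_I(i'):=\{\mathrm{Pa}^{(k)}_{J(i')}(i')\}_k$. Standing assumptions: the $I$-graph is acyclic; every $i$ has finitely many ancestors (finite past). The shallow distribution $P_\theta$ is the probability measure on $\prod_{i\in I}X_i$ whose marginal on any finite ancestor-closed set $A\subset I$ is the causally ordered wired product of the $f_{J(i)}$, $i\in A$. An observable world is a family of random variables $(V_i)_{i\in I}$ with joint law $P_\theta$ such that $V_i=g_i(V_{\mathrm{Pa}_I(i)},\eta_i)$ with measurable $g_i$ and jointly independent $\eta_i\sim U([0,1])$. A viewport is an infinite set $\mathcal N\subset\mathbb N$ and non-random finite sets $\mathsf V(N)\subset I$ ($N\in\mathcal N$), increasing in $N$, with $|\mathsf V(N)|=N$; $\mathbf V:=\bigcup_N\mathsf V(N)$. For the realized data $\mathcal D=(V_i(\omega))_{i\in\mathbf V}$, the realized world is $P_\theta^{\mathcal D}:=P_\theta((V_i)_{i\in I}\mid (V_i)_{i\in\mathbf V}=\mathcal D)$. **Queries.** A basic query $q=(\tilde Y,\tilde X,\theta)$ consists of disjoint finite subsets $\tilde Y,\tilde X\subset I$ and the parameters $\theta=\mathcal F_{\rm intervene}$; its target is (the regular version, a kernel in $x$, of) $P_\theta^{\mathcal D}(V_{\tilde Y}\mid V_{\tilde X}=x)$, and $q$ is identifiable if this kernel is identifiable. An embedding $\psi:\mathcal G\hookrightarrow I$ of a model-aligned structural graph is an injective map $N\to I$ with: (i) for $n\in N_{\rm inner}$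 every $i'\in\mathrm{Pa}_I(\psi(n))$ is in $\psi(N)$; (ii) for $n'\in N_{\rm inner}$ there is an edge $n\to n'$ iff $\psi(n)\in\mathrm{Pa}_I(\psi(n'))$; (iii) $\mu^n=f_{J(\psi(n))}$ for $n\in N_{\rm inner}$. A structured query is an embedding $\psi:\mathcal G\hookrightarrow I$ together with $Y\subset N_{\rm inner}$ such that the empty ancestral structure is valid, i.e. for no $y\in N_{\rm inner}$, $x\in N_{\rm outer}$ is there a directed path from $\psi(y)$ to $\psi(x)$ in the $I$-graph with the $\psi$-images of edges of $\mathcal G$ removed; in the single-level case moreover no node of $\psi(N_{\rm inner})$ is an $I$-graph ancestor of (or contained in) $\mathbf V$. The underlying query is $q(\psi,Y):=(\psi(Y),\psi(N_{\rm outer}),\theta)$. **Identifiability.** A data-set is a tuple $(\mathcal X_j,\mathcal Y_j)_{j\in J_0}$ where $\mathcal X_j=(V_{i^{(1)}_{X,j}},\dots)$ and $\mathcal Y_j=(V_{i^{(1)}_{Y,j}},\dots)$ are finite tuples of variables of the observable world. It is valid if the number of $j\in J_0$ for which all indices of $\mathcal X_j,\mathcal Y_j$ lie in $\mathsf V(N')$ tends to $\infty$ as $N'\to\infty$, and $j\ne j'$ implies $i^{(m)}_{Y,j}\neq i^{(m)}_{Y,j'}$ for all $m$. A kernel $Y_x$ is directly identifiable if there are a valid data-set and probability measures $X_j$ with $P_\theta(\mathcal X_j,\mathcal Y_j)=X_j\otimes Y_x$ for all $j\in J_0$; kernels in $\mathcal F_{\rm intervene}$ are also considered directly identifiable. A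 kernel $\mu$ is identifiable if it can be uniquely computed from finitely many directly identifiable kernels, i.e. $\mu=F[\mu_1,\dots,\mu_n]$ with $F$ a regular functional and all $\mu_i$ directly identifiable.
   Formalization: Condition (iii) of an embedding is taken to include that arguments match parents, ψ(pa^n(k)) = Pa^(k)(ψ(n)); with arbitrarily permuted parents the claim would be false. The value space of an outer node n is taken to be X_{ψ(n)}. *)

theory Defs
  imports "HOL-Probability.Probability" "HOL-Algebra.Group_Action"
begin

section \<open>Standard Borel spaces and tuples\<close>

text \<open>A value of type \<open>'v measure\<close> is used for its underlying measurable space only whenever it
  occurs as a factor of a domain or codomain.\<close>

definition standard_borel :: "'v measure \<Rightarrow> bool" where
  "standard_borel M \<longleftrightarrow>
     (\<exists>T. topspace T = space M \<and> completely_metrizable_space T \<and> second_countable T \<and>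
          sets M = sigma_sets (topspace T) {U. openin T U})"

definition meas_subspace :: "'v measure \<Rightarrow> 'v measure \<Rightarrow> bool" where
  "meas_subspace A B \<longleftrightarrow>
     space A \<subseteq> space B \<and> sets A = sets (restrict_space B (space A))"

definition tspace :: "'v measure list \<Rightarrow> (nat \<Rightarrow> 'v) measure" where
  "tspace As = PiM {..<length As} (\<lambda>k. As ! k)"

definition tpick :: "'i list \<Rightarrow> ('i \<Rightarrow> 'v) \<Rightarrow> nat \<Rightarrow> 'v" where
  "tpick is v = (\<lambda>k\<in>{..<length is}. v (is ! k))"

definition tcat :: "nat \<Rightarrow> nat \<Rightarrow> (nat \<Rightarrow> 'v) \<Rightarrow> (nat \<Rightarrow> 'v) \<Rightarrow> nat \<Rightarrow> 'v" where
  "tcat m n s t = (\<lambda>k\<in>{..<m + n}. if k < m then s k else t (k - m))"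


section \<open>Probability kernels between finite products\<close>

text \<open>The domain and the codomain are lists of factors. The empty list stands for the one-point
  space, so a kernel with empty domain is a probability measure.\<close>

record 'v kernel =
  kdom :: "'v measure list"
  kcod :: "'v measure list"
  kmap :: "(nat \<Rightarrow> 'v) \<Rightarrow> (nat \<Rightarrow> 'v) measure"

definition prob_kernel :: "'v kernel \<Rightarrow> bool" where
  "prob_kernel K \<longleftrightarrow>
     (\<forall>A \<in> set (kdom K) \<union> set (kcod K). standard_borel A) \<and>
     kmap K \<in> tspace (kdom K) \<rightarrow>\<^sub>M prob_algebra (tspace (kcod K))"

text \<open>\<open>sprod As Bs \<mu> \<nu>\<close> is the measure \<open>\<mu> \<otimes> \<nu>\<close> on \<open>As @ Bs\<close>, for a measure \<open>\<mu>\<close> on \<open>As\<close> and a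
  kernel \<open>\<nu>\<close> from \<open>As\<close> to \<open>Bs\<close>.\<close>

definition sprod ::
  "'v measure list \<Rightarrow> 'v measure list \<Rightarrow> (nat \<Rightarrow> 'v) measure \<Rightarrow>
   ((nat \<Rightarrow> 'v) \<Rightarrow> (nat \<Rightarrow> 'v) measure) \<Rightarrow> (nat \<Rightarrow> 'v) measure" where
  "sprod As Bs \<mu> \<nu> =
     bind \<mu> (\<lambda>t. distr (\<nu> t) (tspace (As @ Bs)) (tcat (length As) (length Bs) t))"

definition kprod :: "'v kernel \<Rightarrow> 'v kernel \<Rightarrow> 'v kernel" where
  "kprod \<mu> \<nu> =
     \<lparr>kdom = kdom \<mu>, kcod = kcod \<mu> @ kcod \<nu>,
      kmap = (\<lambda>s. sprod (kcod \<mu>) (kcod \<nu>) (kmap \<mu> s)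
                   (\<lambda>t. kmap \<nu> (tcat (length (kdom \<mu>)) (length (kcod \<mu>)) s t)))\<rparr>"

definition kselect :: "nat list \<Rightarrow> 'v kernel \<Rightarrow> 'v kernel" where
  "kselect js K =
     \<lparr>kdom = kdom K, kcod = map (\<lambda>j. kcod K ! j) js,
      kmap = (\<lambda>s. distr (kmap K s) (tspace (map (\<lambda>j. kcod K ! j) js)) (tpick js))\<rparr>"

text \<open>A kernel regarded as a kernel with further arguments on which it depends trivially: entry
  \<open>ws ! k\<close> is the position, among the factors \<open>As\<close> of the new domain, of the \<open>k\<close>-th argument.
  At the same time an argument may be restricted to a subspace and a target factor may be
  regarded as a subspace of a larger space.\<close>

definition kregard ::
  "'v measure list \<Rightarrow> nat list \<Rightarrow> 'v measure list \<Rightarrow> 'v kernel \<Rightarrow> 'v kernel" where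
  "kregard As ws Bs K =
     \<lparr>kdom = As, kcod = Bs,
      kmap = (\<lambda>s. distr (kmap K (tpick ws s)) (tspace Bs) (\<lambda>t. t))\<rparr>"

definition regardable ::
  "'v measure list \<Rightarrow> nat list \<Rightarrow> 'v measure list \<Rightarrow> 'v kernel \<Rightarrow> bool" where
  "regardable As ws Bs K \<longleftrightarrow>
     (\<forall>A \<in> set As \<union> set Bs. standard_borel A) \<and>
     distinct ws \<and> set ws \<subseteq> {..<length As} \<and>
     list_all2 meas_subspace (map (\<lambda>w. As ! w) ws) (kdom K) \<and>
     list_all2 meas_subspace (kcod K) Bs"


section \<open>Regular functionals\<close>

text \<open>\<open>Prod\<close> is the product, \<open>RMarg p\<close> keeps the first \<open>p\<close> target factors, \<open>LDisint p\<close>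
  disintegrates along the first \<open>p\<close> target factors, \<open>Transp js\<close> reorders the target factors, and
  \<open>Regard\<close> makes the implicit change of domain and codomain explicit.\<close>

datatype 'v regular_functional =
    Arg nat
  | Prod "'v regular_functional" "'v regular_functional"
  | RMarg nat "'v regular_functional"
  | LDisint nat "'v regular_functional"
  | Transp "nat list" "'v regular_functional"
  | Regard "'v measure list" "nat list" "'v measure list" "'v regular_functional"

definition prob_on :: "'v measure list \<Rightarrow> (nat \<Rightarrow> 'v) measure \<Rightarrow> bool" where
  "prob_on As \<rho> \<longleftrightarrow> prob_space \<rho> \<and> sets \<rho> = sets (tspace As)"

text \<open>A kernel that is only determined up to null sets is represented by a pair \<open>(K, \<rho>)\<close>, where
  \<open>\<rho>\<close> is a probability measure on the domain of \<open>K\<close> and only the values of \<open>K\<close> at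
  \<open>\<rho>\<close>-almost every argument are meaningful. \<open>reg_value \<Gamma> F K \<rho>\<close> states
  that the value \<open>F[\<Gamma>]\<close> is determined \<open>\<rho>\<close>-almost everywhere and equals \<open>K\<close> there.

  A disintegration \<open>\<nu>\<close> of \<open>\<mu> \<otimes> \<nu>\<close> is thus only available relative to \<open>\<mu>\<close>
  (rule \<open>LDisint\<close>), hence by rule \<open>version\<close> relative to every \<open>\<xi> \<lless> \<mu>\<close>,
  and a product \<open>\<xi> \<otimes> \<nu>\<close> may only be formed if \<open>\<nu>\<close> is available relative to \<open>\<xi>\<close>
  (rule \<open>Prod\<close>). This implements the requirement that disintegrations be used only in products
  \<open>\<xi> \<otimes> \<nu>\<close> with \<open>\<xi>\<close> absolutely continuous with respect to \<open>\<mu>\<close>.\<close>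

inductive reg_value ::
  "('v kernel \<times> (nat \<Rightarrow> 'v) measure) list \<Rightarrow> 'v regular_functional \<Rightarrow>
   'v kernel \<Rightarrow> (nat \<Rightarrow> 'v) measure \<Rightarrow> bool"
  for \<Gamma> where
  Arg: "n < length \<Gamma> \<Longrightarrow> prob_kernel (fst (\<Gamma> ! n)) \<Longrightarrow>
        prob_on (kdom (fst (\<Gamma> ! n))) (snd (\<Gamma> ! n)) \<Longrightarrow>
        reg_value \<Gamma> (Arg n) (fst (\<Gamma> ! n)) (snd (\<Gamma> ! n))"
| Prod: "reg_value \<Gamma> F K \<rho> \<Longrightarrow> kdom K' = kdom K @ kcod K \<Longrightarrow>
         reg_value \<Gamma> F' K' (sprod (kdom K) (kcod K) \<rho> (kmap K)) \<Longrightarrow>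
         reg_value \<Gamma> (Prod F F') (kprod K K') \<rho>"
| RMarg: "reg_value \<Gamma> F K \<rho> \<Longrightarrow> p \<le> length (kcod K) \<Longrightarrow>
          reg_value \<Gamma> (RMarg p F) (kselect [0..<p] K) \<rho>"
| LDisint: "reg_value \<Gamma> F K \<rho> \<Longrightarrow> p \<le> length (kcod K) \<Longrightarrow> \<mu> = kselect [0..<p] K \<Longrightarrow>
            prob_kernel \<nu> \<Longrightarrow> kdom \<nu> = kdom K @ take p (kcod K) \<Longrightarrow> kcod \<nu> = drop p (kcod K) \<Longrightarrow>
            (AE s in \<rho>. kmap (kprod \<mu> \<nu>) s = kmap K s) \<Longrightarrow>
            reg_value \<Gamma> (LDisint p F) \<nu> (sprod (kdom \<mu>) (kcod \<mu>) \<rho> (kmap \<mu>))"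
| Transp: "reg_value \<Gamma> F K \<rho> \<Longrightarrow> distinct js \<Longrightarrow> set js = {..<length (kcod K)} \<Longrightarrow>
           reg_value \<Gamma> (Transp js F) (kselect js K) \<rho>"
| Regard: "reg_value \<Gamma> F K (distr \<rho> (tspace (kdom K)) (tpick ws)) \<Longrightarrow>
           prob_on As \<rho> \<Longrightarrow> regardable As ws Bs K \<Longrightarrow>
           reg_value \<Gamma> (Regard As ws Bs F) (kregard As ws Bs K) \<rho>"
| version: "reg_value \<Gamma> F K \<rho> \<Longrightarrow> prob_kernel K' \<Longrightarrow> kdom K' = kdom K \<Longrightarrow> kcod K' = kcod K \<Longrightarrow>
            prob_on (kdom K) \<rho>' \<Longrightarrow> absolutely_continuous \<rho> \<rho>' \<Longrightarrow>
            (AE s in \<rho>'. kmap K' s = kmap K s) \<Longrightarrow>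
            reg_value \<Gamma> F K' \<rho>'"


section \<open>Causally ordered products and structured kernels\<close>

definition position :: "'n list \<Rightarrow> 'n \<Rightarrow> nat" where
  "position ns n = (LEAST k. k < length ns \<and> ns ! k = n)"

definition causal_order :: "('n \<times> 'n) set \<Rightarrow> 'n set \<Rightarrow> 'n list \<Rightarrow> bool" where
  "causal_order E A ns \<longleftrightarrow>
     distinct ns \<and> set ns = A \<and> (\<forall>a b. a < b \<and> b < length ns \<longrightarrow> (ns ! b, ns ! a) \<notin> E)"

text \<open>\<open>wired_product f pa val os ns\<close> is the product of the kernels \<open>f n\<close> along \<open>ns\<close>, with the
  values of the nodes \<open>os\<close> as arguments; the arguments of \<open>f n\<close> are the values of the
  nodes listed in \<open>pa n\<close>, and \<open>val n\<close> is the value space of node \<open>n\<close>.\<close>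

primrec wired_product ::
  "('n \<Rightarrow> 'v kernel) \<Rightarrow> ('n \<Rightarrow> 'n list) \<Rightarrow> ('n \<Rightarrow> 'v measure) \<Rightarrow> 'n list \<Rightarrow> 'n list \<Rightarrow> 'v kernel" where
  "wired_product f pa val os [] =
     \<lparr>kdom = map val os, kcod = [], kmap = (\<lambda>_. return (tspace []) (\<lambda>_. undefined))\<rparr>"
| "wired_product f pa val os (n # ns) =
     kprod (kregard (map val os) (map (position os) (pa n)) [val n] (f n))
           (wired_product f pa val (os @ [n]) ns)"

text \<open>The list \<open>sg_pa G n\<close> enumerates the parents of \<open>n\<close> without repetition: it is the
  bijection from argument positions to parents.\<close>

record ('n, 'v) sgraph =
  sg_inner :: "'n set"
  sg_outer :: "'n set"
  sg_edges :: "('n \<times> 'n) set"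
  sg_kern :: "'n \<Rightarrow> 'v kernel"
  sg_pa :: "'n \<Rightarrow> 'n list"
  sg_val :: "'n \<Rightarrow> 'v measure"

definition structural_graph :: "('n, 'v) sgraph \<Rightarrow> bool" where
  "structural_graph G \<longleftrightarrow>
     finite (sg_inner G) \<and> finite (sg_outer G) \<and> sg_inner G \<inter> sg_outer G = {} \<and>
     sg_edges G \<subseteq> (sg_inner G \<union> sg_outer G) \<times> sg_inner G"

definition model_aligned :: "('n, 'v) sgraph \<Rightarrow> bool" where
  "model_aligned G \<longleftrightarrow>
     structural_graph G \<and> acyclic (sg_edges G) \<and>
     (\<forall>n \<in> sg_outer G. standard_borel (sg_val G n)) \<and>
     (\<forall>n \<in> sg_inner G.
        prob_kernel (sg_kern G n) \<and> kcod (sg_kern G n) = [sg_val G n] \<and>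
        distinct (sg_pa G n) \<and> set (sg_pa G n) = {m. (m, n) \<in> sg_edges G} \<and>
        list_all2 meas_subspace (map (sg_val G) (sg_pa G n)) (kdom (sg_kern G n)))"

text \<open>The structured kernel of \<open>G\<close> and \<open>L\<close>, computed along a causal order \<open>ns\<close> of the inner
  nodes and with the arguments ordered as in \<open>os\<close>.\<close>

definition structured_kernel :: "('n, 'v) sgraph \<Rightarrow> 'n list \<Rightarrow> 'n list \<Rightarrow> 'n set \<Rightarrow> 'v kernel" where
  "structured_kernel G os ns L =
     kselect (filter (\<lambda>k. ns ! k \<notin> L) [0..<length ns])
       (wired_product (sg_kern G) (sg_pa G) (sg_val G) os ns)"


section \<open>Models\<close>

text \<open>The mechanisms are indexed by their regions; \<open>m_par M J j\<close> is the tuple of parents that the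
  mechanism of region \<open>J\<close> assigns to \<open>j\<close>.\<close>

record ('i, 'g, 'v) model =
  m_idx :: "'i set"
  m_val :: "'i \<Rightarrow> 'v measure"
  m_group :: "'g monoid"
  m_act :: "'g \<Rightarrow> 'i \<Rightarrow> 'i"
  m_regions :: "'i set set"
  m_mech :: "'i set \<Rightarrow> 'v kernel"
  m_sym :: "'i set \<Rightarrow> 'g set"
  m_par :: "'i set \<Rightarrow> 'i \<Rightarrow> 'i list"
  m_known :: "'i set set"

definition mechanism :: "('i, 'g, 'v) model \<Rightarrow> 'i set \<Rightarrow> bool" where
  "mechanism M J \<longleftrightarrow>
     J \<subseteq> m_idx M \<and>
     subgroup (m_sym M J) (m_group M) \<and>
     (\<forall>h \<in> m_sym M J. \<forall>j \<in> J. m_act M h j \<in> J) \<and>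
     (\<forall>j \<in> J. \<forall>j' \<in> J. \<exists>h \<in> m_sym M J. m_act M h j = j') \<and>
     (\<forall>h \<in> m_sym M J. \<forall>j \<in> J. m_act M h j = j \<longrightarrow> h = \<one>\<^bsub>m_group M\<^esub>) \<and>
     (\<forall>h \<in> m_sym M J. \<forall>j \<in> J. m_par M J (m_act M h j) = map (m_act M h) (m_par M J j)) \<and>
     prob_kernel (m_mech M J) \<and> length (kcod (m_mech M J)) = 1 \<and>
     (\<forall>j \<in> J.
        set (m_par M J j) \<subseteq> m_idx M \<and> j \<notin> set (m_par M J j) \<and> distinct (m_par M J j) \<and>
        list_all2 meas_subspace (map (m_val M) (m_par M J j)) (kdom (m_mech M J)) \<and>
        meas_subspace (kcod (m_mech M J) ! 0) (m_val M j))"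

definition causal_model :: "('i, 'g, 'v) model \<Rightarrow> bool" where
  "causal_model M \<longleftrightarrow>
     countable (m_idx M) \<and> (\<forall>i \<in> m_idx M. standard_borel (m_val M i)) \<and>
     faithful_action (m_group M) (m_idx M) (m_act M) \<and>
     partition_on (m_idx M) (m_regions M) \<and> (\<forall>J \<in> m_regions M. mechanism M J) \<and>
     m_known M \<subseteq> m_regions M"

definition region_of :: "('i, 'g, 'v) model \<Rightarrow> 'i \<Rightarrow> 'i set" where
  "region_of M i = (THE J. J \<in> m_regions M \<and> i \<in> J)"

definition mech_at :: "('i, 'g, 'v) model \<Rightarrow> 'i \<Rightarrow> 'v kernel" where
  "mech_at M i = m_mech M (region_of M i)"

definition par_at :: "('i, 'g, 'v) model \<Rightarrow> 'i \<Rightarrow> 'i list" where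
  "par_at M i = m_par M (region_of M i) i"

definition intervene :: "('i, 'g, 'v) model \<Rightarrow> 'v kernel set" where
  "intervene M = m_mech M ` m_known M"

definition iedges :: "('i, 'g, 'v) model \<Rightarrow> ('i \<times> 'i) set" where
  "iedges M = {(i, i'). i' \<in> m_idx M \<and> i \<in> set (par_at M i')}"

definition finite_past :: "('i, 'g, 'v) model \<Rightarrow> bool" where
  "finite_past M \<longleftrightarrow> (\<forall>i \<in> m_idx M. finite {a. (a, i) \<in> (iedges M)\<^sup>+})"

definition world_space :: "('i, 'g, 'v) model \<Rightarrow> ('i \<Rightarrow> 'v) measure" where
  "world_space M = PiM (m_idx M) (m_val M)"

text \<open>The law of the tuple of variables listed in \<open>is\<close> when the world is distributed as \<open>Q\<close>.\<close>

definition tuple_law ::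
  "('i, 'g, 'v) model \<Rightarrow> ('i \<Rightarrow> 'v) measure \<Rightarrow> 'i list \<Rightarrow> (nat \<Rightarrow> 'v) measure" where
  "tuple_law M Q is = distr Q (tspace (map (m_val M) is)) (tpick is)"

definition shallow_distribution :: "('i, 'g, 'v) model \<Rightarrow> ('i \<Rightarrow> 'v) measure \<Rightarrow> bool" where
  "shallow_distribution M P \<longleftrightarrow>
     prob_space P \<and> sets P = sets (world_space M) \<and>
     (\<forall>A is. finite A \<and> A \<subseteq> m_idx M \<and> (\<forall>i \<in> A. set (par_at M i) \<subseteq> A) \<and>
        causal_order (iedges M) A is \<longrightarrow>
        tuple_law M P is =
          kmap (wired_product (mech_at M) (par_at M) (m_val M) [] is) (\<lambda>_. undefined))"

definition observable_world ::
  "('i, 'g, 'v) model \<Rightarrow> ('i \<Rightarrow> 'v) measure \<Rightarrow> 'w measure \<Rightarrow> ('i \<Rightarrow> 'w \<Rightarrow> 'v) \<Rightarrow> bool" where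
  "observable_world M P \<Omega> V \<longleftrightarrow>
     prob_space \<Omega> \<and> (\<forall>i \<in> m_idx M. V i \<in> \<Omega> \<rightarrow>\<^sub>M m_val M i) \<and>
     distr \<Omega> (world_space M) (\<lambda>\<omega>. \<lambda>i\<in>m_idx M. V i \<omega>) = P \<and>
     (\<exists>g (\<eta> :: 'i \<Rightarrow> 'w \<Rightarrow> real).
        prob_space.indep_vars \<Omega> (\<lambda>_. borel) \<eta> (m_idx M) \<and>
        (\<forall>i \<in> m_idx M.
           distr \<Omega> borel (\<eta> i) = uniform_measure lborel {0..1} \<and>
           g i \<in> tspace (map (m_val M) (par_at M i)) \<Otimes>\<^sub>M borel \<rightarrow>\<^sub>M m_val M i \<and>
           (\<forall>\<omega> \<in> space \<Omega>. V i \<omega> = g i (tpick (par_at M i) (\<lambda>j. V j \<omega>), \<eta> i \<omega>))))"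

definition viewport :: "('i, 'g, 'v) model \<Rightarrow> nat set \<Rightarrow> (nat \<Rightarrow> 'i set) \<Rightarrow> bool" where
  "viewport M Ns W \<longleftrightarrow>
     infinite Ns \<and> (\<forall>N \<in> Ns. finite (W N) \<and> W N \<subseteq> m_idx M \<and> card (W N) = N) \<and>
     (\<forall>N \<in> Ns. \<forall>N' \<in> Ns. N \<le> N' \<longrightarrow> W N \<subseteq> W N')"

definition visible :: "nat set \<Rightarrow> (nat \<Rightarrow> 'i set) \<Rightarrow> 'i set" where
  "visible Ns W = (\<Union>N \<in> Ns. W N)"

text \<open>\<open>PD\<close> is a regular version of the conditional distribution of the world given the
  variables with index in \<open>VV\<close>.\<close>

definition realized_world ::
  "('i, 'g, 'v) model \<Rightarrow> ('i \<Rightarrow> 'v) measure \<Rightarrow> 'i set \<Rightarrow>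
   (('i \<Rightarrow> 'v) \<Rightarrow> ('i \<Rightarrow> 'v) measure) \<Rightarrow> bool" where
  "realized_world M P VV PD \<longleftrightarrow>
     PD \<in> PiM VV (m_val M) \<rightarrow>\<^sub>M prob_algebra (world_space M) \<and>
     (\<forall>A \<in> sets (PiM VV (m_val M)). \<forall>B \<in> sets (world_space M).
        emeasure P {v \<in> space P. restrict v VV \<in> A \<and> v \<in> B} =
        (\<integral>\<^sup>+D\<in>A. emeasure (PD D) B \<partial>distr P (PiM VV (m_val M)) (\<lambda>v. restrict v VV)))"


section \<open>Identifiability\<close>

text \<open>A data-set is a family of pairs of tuples of variables, given by the index tuples
  \<open>xs j\<close>, \<open>ys j\<close> for \<open>j \<in> J0\<close>. In case the tuples \<open>ys j\<close> are empty, the number of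
  visible \<open>j\<close> may be infinite, where \<open>card\<close> would be \<open>0\<close>.\<close>

definition valid_data_set ::
  "('i, 'g, 'v) model \<Rightarrow> nat set \<Rightarrow> (nat \<Rightarrow> 'i set) \<Rightarrow> nat set \<Rightarrow> (nat \<Rightarrow> 'i list) \<Rightarrow>
   (nat \<Rightarrow> 'i list) \<Rightarrow> bool" where
  "valid_data_set M Ns W J0 xs ys \<longleftrightarrow>
     (\<forall>j \<in> J0. set (xs j) \<union> set (ys j) \<subseteq> m_idx M) \<and>
     (\<forall>c. \<forall>\<^sub>F N in sequentially. N \<in> Ns \<longrightarrow>
        infinite {j \<in> J0. set (xs j) \<union> set (ys j) \<subseteq> W N} \<or>
        c \<le> card {j \<in> J0. set (xs j) \<union> set (ys j) \<subseteq> W N}) \<and>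
     (\<forall>j \<in> J0. \<forall>j' \<in> J0. j \<noteq> j' \<longrightarrow>
        (\<forall>m. m < length (ys j) \<and> m < length (ys j') \<longrightarrow> ys j ! m \<noteq> ys j' ! m))"

text \<open>A kernel \<open>K\<close> obtained from a data-set is determined up to sets that are null for all input
  laws \<open>X j\<close>, a kernel known a priori is determined everywhere. The map \<open>kregard\<close> accounts for
  \<open>m_val M i\<close> being a subspace of the domain factor, or containing the target factor, of \<open>K\<close>.\<close>

definition directly_identifiable ::
  "('i, 'g, 'v) model \<Rightarrow> ('i \<Rightarrow> 'v) measure \<Rightarrow> nat set \<Rightarrow> (nat \<Rightarrow> 'i set) \<Rightarrow>
   'v kernel \<Rightarrow> (nat \<Rightarrow> 'v) measure \<Rightarrow> bool" where
  "directly_identifiable M P Ns W K \<rho> \<longleftrightarrow>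
     prob_kernel K \<and> prob_on (kdom K) \<rho> \<and>
     (K \<in> intervene M \<or>
      (\<exists>J0 xs ys X. valid_data_set M Ns W J0 xs ys \<and>
         (\<forall>j \<in> J0.
            let As = map (m_val M) (xs j); Bs = map (m_val M) (ys j); ws = [0..<length (xs j)]
            in prob_on As (X j) \<and> regardable As ws Bs K \<and>
               tuple_law M P (xs j @ ys j) = sprod As Bs (X j) (kmap (kregard As ws Bs K))) \<and>
         (\<forall>A \<in> sets (tspace (kdom K)).
            (\<forall>j \<in> J0. emeasure (distr (X j) (tspace (kdom K)) (\<lambda>s. s)) A = 0) \<longrightarrow>
            emeasure \<rho> A = 0)))"

definition identifiable ::
  "('i, 'g, 'v) model \<Rightarrow> ('i \<Rightarrow> 'v) measure \<Rightarrow> nat set \<Rightarrow> (nat \<Rightarrow> 'i set) \<Rightarrow>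
   'v kernel \<Rightarrow> (nat \<Rightarrow> 'v) measure \<Rightarrow> bool" where
  "identifiable M P Ns W K \<rho> \<longleftrightarrow>
     (\<exists>F \<Gamma>. (\<forall>(\<mu>, \<sigma>) \<in> set \<Gamma>. directly_identifiable M P Ns W \<mu> \<sigma>) \<and> reg_value \<Gamma> F K \<rho>)"


section \<open>Queries\<close>

type_synonym ('i, 'v) query = "'i set \<times> 'i set \<times> 'v kernel set"

definition basic_query :: "('i, 'g, 'v) model \<Rightarrow> ('i, 'v) query \<Rightarrow> bool" where
  "basic_query M q \<longleftrightarrow> (case q of (Y, X, \<theta>) \<Rightarrow>
     finite Y \<and> finite X \<and> Y \<subseteq> m_idx M \<and> X \<subseteq> m_idx M \<and> Y \<inter> X = {} \<and> \<theta> = intervene M)"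

text \<open>\<open>K\<close> is a regular version of the conditional law of \<open>V\<^bsub>ys\<^esub>\<close> given \<open>V\<^bsub>xs\<^esub>\<close> under \<open>Q\<close>.\<close>

definition conditional_kernel ::
  "('i, 'g, 'v) model \<Rightarrow> ('i \<Rightarrow> 'v) measure \<Rightarrow> 'i list \<Rightarrow> 'i list \<Rightarrow> 'v kernel \<Rightarrow> bool" where
  "conditional_kernel M Q ys xs K \<longleftrightarrow>
     prob_kernel K \<and> kdom K = map (m_val M) xs \<and> kcod K = map (m_val M) ys \<and>
     tuple_law M Q (xs @ ys) =
       sprod (map (m_val M) xs) (map (m_val M) ys) (tuple_law M Q xs) (kmap K)"

text \<open>The target of a query is a function of the realized data and of \<open>x\<close> that is defined up
  to null sets only. Therefore the kernel \<open>K\<close> is chosen before the realization \<open>\<omega>\<close>, and is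
  determined up to null sets of the law of \<open>V\<^bsub>xs\<^esub>\<close>: if it could depend on \<open>\<omega>\<close>, it could be
  altered on a null set that has positive measure in the realized world, for example at the
  observed value of \<open>V\<^bsub>xs\<^esub>\<close>.\<close>

definition query_identifiable ::
  "('i, 'g, 'v) model \<Rightarrow> ('i \<Rightarrow> 'v) measure \<Rightarrow> nat set \<Rightarrow> (nat \<Rightarrow> 'i set) \<Rightarrow>
   'w measure \<Rightarrow> ('i \<Rightarrow> 'w \<Rightarrow> 'v) \<Rightarrow> (('i \<Rightarrow> 'v) \<Rightarrow> ('i \<Rightarrow> 'v) measure) \<Rightarrow>
   ('i, 'v) query \<Rightarrow> bool" where
  "query_identifiable M P Ns W \<Omega> V PD q \<longleftrightarrow>
     basic_query M q \<and>
     (case q of (Y, X, \<theta>) \<Rightarrow>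
        \<exists>ys xs K. distinct ys \<and> set ys = Y \<and> distinct xs \<and> set xs = X \<and>
          identifiable M P Ns W K (tuple_law M P xs) \<and>
          (AE \<omega> in \<Omega>. conditional_kernel M (PD (\<lambda>i\<in>visible Ns W. V i \<omega>)) ys xs K))"

text \<open>The condition \<open>sg_kern G n = mech_at M (\<psi> n)\<close> is read as including the assignment of
  arguments to parents; otherwise the parents could be permuted.\<close>

definition embedding ::
  "('i, 'g, 'v) model \<Rightarrow> ('n, 'v) sgraph \<Rightarrow> ('n \<Rightarrow> 'i) \<Rightarrow> bool" where
  "embedding M G \<psi> \<longleftrightarrow>
     model_aligned G \<and>
     inj_on \<psi> (sg_inner G \<union> sg_outer G) \<and> \<psi> ` (sg_inner G \<union> sg_outer G) \<subseteq> m_idx M \<and>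
     (\<forall>n \<in> sg_inner G. set (par_at M (\<psi> n)) \<subseteq> \<psi> ` (sg_inner G \<union> sg_outer G)) \<and>
     (\<forall>n' \<in> sg_inner G. \<forall>n \<in> sg_inner G \<union> sg_outer G.
        (n, n') \<in> sg_edges G \<longleftrightarrow> \<psi> n \<in> set (par_at M (\<psi> n'))) \<and>
     (\<forall>n \<in> sg_inner G.
        sg_kern G n = mech_at M (\<psi> n) \<and> map \<psi> (sg_pa G n) = par_at M (\<psi> n)) \<and>
     (\<forall>n \<in> sg_outer G. sets (sg_val G n) = sets (m_val M (\<psi> n)))"

definition empty_ancestral_valid ::
  "('i, 'g, 'v) model \<Rightarrow> ('n, 'v) sgraph \<Rightarrow> ('n \<Rightarrow> 'i) \<Rightarrow> bool" where
  "empty_ancestral_valid M G \<psi> \<longleftrightarrow>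
     (\<forall>y \<in> sg_inner G. \<forall>x \<in> sg_outer G.
        (\<psi> y, \<psi> x) \<notin> (iedges M - map_prod \<psi> \<psi> ` sg_edges G)\<^sup>*)"

text \<open>The last conjunct is the requirement specific to the single-level case.\<close>

definition structured_query ::
  "('i, 'g, 'v) model \<Rightarrow> 'i set \<Rightarrow> ('n, 'v) sgraph \<Rightarrow> ('n \<Rightarrow> 'i) \<Rightarrow> 'n set \<Rightarrow> bool" where
  "structured_query M VV G \<psi> Y \<longleftrightarrow>
     embedding M G \<psi> \<and> Y \<subseteq> sg_inner G \<and> empty_ancestral_valid M G \<psi> \<and>
     (\<forall>n \<in> sg_inner G. \<forall>v \<in> VV. (\<psi> n, v) \<notin> (iedges M)\<^sup>*)"

definition underlying_query ::
  "('i, 'g, 'v) model \<Rightarrow> ('n, 'v) sgraph \<Rightarrow> ('n \<Rightarrow> 'i) \<Rightarrow> 'n set \<Rightarrow> ('i, 'v) query" where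
  "underlying_query M G \<psi> Y = (\<psi> ` Y, \<psi> ` sg_outer G, intervene M)"

end

theory Submission
  imports Defs
begin

text \<open>Identifiable kernels may be substituted for the arguments of a regular functional, so the
  structured kernel is identifiable, and it remains to see that it is a version of the conditional
  law of \<open>V\<^bsub>\<psi>(Y)\<^esub>\<close> given \<open>V\<^bsub>\<psi>(N_outer)\<^esub>\<close> in the realized world. The indices that are not descendants
  of inner nodes form an ancestor-closed set, which contains the visible indices by assumption and
  the outer nodes because the empty ancestral structure is valid. For a finite ancestor-closed part
  \<open>A\<close> of this set containing the outer nodes, a causal order of \<open>A\<close> followed by the inner nodes is a
  causal order of an ancestor-closed set. Hence under \<open>P\<close> the inner nodes are distributed, given
  \<open>V\<^bsub>A\<^esub>\<close>, according to the wired product of the graph, which depends on the outer nodes only. A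
  \<open>\<pi>\<close>-\<open>\<lambda>\<close> argument replaces \<open>A\<close> by the possibly infinite visible set, and disintegrating
  along the visible variables gives the claim for almost every realization, since the tuple spaces
  are countably generated.\<close>

section \<open>Tuple spaces and measurability of tuple maps\<close>

lemma space_tspace: "space (tspace As) = (\<Pi>\<^sub>E k\<in>{..<length As}. space (As ! k))"
  by (simp add: tspace_def space_PiM)

lemma tspace_component: "k < length As \<Longrightarrow> (\<lambda>t. t k) \<in> tspace As \<rightarrow>\<^sub>M As ! k"
  unfolding tspace_def by (rule measurable_component_singleton) simp

lemma measurable_into_tspace:
  assumes "\<And>k. k < length As \<Longrightarrow> (\<lambda>x. f x k) \<in> N \<rightarrow>\<^sub>M As ! k"
    and "n = length As"
  shows "(\<lambda>x. \<lambda>k\<in>{..<n}. f x k) \<in> N \<rightarrow>\<^sub>M tspace As"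
  unfolding tspace_def assms(2) by (rule measurable_restrict) (use assms in auto)

lemma measurable_tpick:
  assumes "length As = length is"
    and "\<And>k. k < length is \<Longrightarrow> (\<lambda>v. v (is ! k)) \<in> N \<rightarrow>\<^sub>M As ! k"
  shows "tpick is \<in> N \<rightarrow>\<^sub>M tspace As"
proof -
  have "(\<lambda>v. \<lambda>k\<in>{..<length is}. v (is ! k)) \<in> N \<rightarrow>\<^sub>M tspace As"
    by (rule measurable_into_tspace) (use assms in auto)
  then show ?thesis unfolding tpick_def[abs_def] .
qed

lemma measurable_tpick_map:
  assumes "\<And>i. i \<in> set is \<Longrightarrow> (\<lambda>v. v i) \<in> N \<rightarrow>\<^sub>M val i"
  shows "tpick is \<in> N \<rightarrow>\<^sub>M tspace (map val is)"
  by (rule measurable_tpick) (use assms in auto)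

lemma measurable_tpick_PiM:
  "set is \<subseteq> I \<Longrightarrow> tpick is \<in> PiM I val \<rightarrow>\<^sub>M tspace (map val is)"
  by (rule measurable_tpick_map) (auto intro: measurable_component_singleton)

lemma measurable_tpick_tspace:
  "set js \<subseteq> {..<length As} \<Longrightarrow> tpick js \<in> tspace As \<rightarrow>\<^sub>M tspace (map (\<lambda>j. As ! j) js)"
  by (rule measurable_tpick_map) (auto intro: tspace_component)

lemma measurable_tcat:
  assumes "f \<in> N \<rightarrow>\<^sub>M tspace As" "g \<in> N \<rightarrow>\<^sub>M tspace Bs"
    and "m = length As" "n = length Bs"
  shows "(\<lambda>x. tcat m n (f x) (g x)) \<in> N \<rightarrow>\<^sub>M tspace (As @ Bs)"
  unfolding tcat_def
proof (rule measurable_into_tspace)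
  fix k assume k: "k < length (As @ Bs)"
  show "(\<lambda>x. if k < m then f x k else g x (k - m)) \<in> N \<rightarrow>\<^sub>M (As @ Bs) ! k"
  proof (cases "k < m")
    case True
    then show ?thesis
      using measurable_compose[OF assms(1) tspace_component[of k As]] assms(3)
      by (simp add: nth_append)
  next
    case False
    then show ?thesis
      using measurable_compose[OF assms(2) tspace_component[of "k - m" Bs]] assms(3) k
      by (simp add: nth_append)
  qed
qed (use assms in simp)

lemma tspace_cong:
  assumes "list_all2 (\<lambda>A B. sets A = sets B) As Bs"
  shows "sets (tspace As) = sets (tspace Bs)"
  using assms unfolding tspace_def by (intro sets_PiM_cong) (auto simp: list_all2_conv_all_nth)

lemma tpick_in_tspace:
  "(\<And>i. i \<in> set is \<Longrightarrow> v i \<in> space (val i)) \<Longrightarrow> tpick is v \<in> space (tspace (map val is))"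
  by (auto simp: tpick_def space_tspace)

lemma tpick_cong: "(\<And>i. i \<in> set is \<Longrightarrow> v i = w i) \<Longrightarrow> tpick is v = tpick is w"
  by (auto simp: tpick_def)

lemma tcat_tpick: "tcat (length xs) (length ys) (tpick xs v) (tpick ys v) = tpick (xs @ ys) v"
  by (auto simp: tcat_def tpick_def nth_append fun_eq_iff)

lemma position_nth: "m \<in> set os \<Longrightarrow> position os m < length os \<and> os ! position os m = m"
  unfolding position_def by (rule LeastI_ex) (simp add: in_set_conv_nth)

lemma position_less: "m \<in> set os \<Longrightarrow> position os m < length os"
  and nth_position: "m \<in> set os \<Longrightarrow> os ! position os m = m"
  using position_nth[of m os] by auto

text \<open>The bridge between positions and nodes: arguments looked up by position in a tuple over
  \<open>os\<close> are the values of the environment \<open>v\<close> at the nodes themselves,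
  whatever the order of \<open>os\<close>.\<close>

lemma tpick_position:
  "set ms \<subseteq> set os \<Longrightarrow> tpick (map (position os) ms) (tpick os v) = tpick ms v"
  by (auto simp: tpick_def fun_eq_iff position_less nth_position subset_iff)

lemma tpick_tpick:
  "set js \<subseteq> {..<length is} \<Longrightarrow> tpick js (tpick is v) = tpick (map (\<lambda>j. is ! j) js) v"
  by (auto simp: tpick_def fun_eq_iff subset_iff)

text \<open>\<open>tpick\<close> overwrites everything outside its index range by
  \<open>undefined\<close>, so it acts as the identity on members of the tuple space because these
  are extensional.\<close>

lemma tpick_upt_tspace:
  "s \<in> space (tspace As) \<Longrightarrow> tpick [0..<length As] s = s"
  by (fastforce simp: tpick_def fun_eq_iff space_tspace PiE_def extensional_def)

section \<open>Measurable subspaces\<close>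

lemma meas_subspace_sets_eq:
  assumes "sets A = sets B"
  shows "meas_subspace A B"
proof -
  have "sets (restrict_space B (space B)) = sets B"
    using sets.sets_into_space by (fastforce simp: sets_restrict_space)
  then show ?thesis
    using assms sets_eq_imp_space_eq[OF assms] by (simp add: meas_subspace_def)
qed

lemma measurable_meas_subspace:
  assumes "meas_subspace A B" "f \<in> N \<rightarrow>\<^sub>M A"
  shows "f \<in> N \<rightarrow>\<^sub>M B"
proof -
  have "f \<in> N \<rightarrow>\<^sub>M restrict_space B (space A)"
    using assms measurable_cong_sets unfolding meas_subspace_def by blast
  then show ?thesis by (simp add: measurable_restrict_space2_iff)
qed

lemma measurable_tspace_meas_subspace:
  assumes "list_all2 meas_subspace As Bs" "f \<in> N \<rightarrow>\<^sub>M tspace As"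
  shows "f \<in> N \<rightarrow>\<^sub>M tspace Bs"
proof -
  have "(\<lambda>t. t) \<in> tspace As \<rightarrow>\<^sub>M tspace Bs"
  proof -
    \<comment> \<open>On extensional tuples the identity equals its restriction to the index range,
      and measurability of the latter can be checked component by component.\<close>
    have "(\<lambda>t. \<lambda>k\<in>{..<length As}. t k) \<in> tspace As \<rightarrow>\<^sub>M tspace Bs"
      using assms(1) by (intro measurable_into_tspace)
        (auto simp: list_all2_conv_all_nth intro!: measurable_meas_subspace[OF _ tspace_component])
    then show ?thesis
      by (rule measurable_cong[THEN iffD1, rotated]) (auto simp: space_tspace extensional_restrict PiE_def)
  qed
  from measurable_compose[OF assms(2) this] show ?thesis by simp
qed

lemma measurable_tpick_regardable:
  assumes "regardable As ws Bs K"
  shows "tpick ws \<in> tspace As \<rightarrow>\<^sub>M tspace (kdom K)"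
  using assms measurable_tspace_meas_subspace[OF _ measurable_tpick_tspace]
  by (auto simp: regardable_def)

section \<open>Kernels\<close>

lemma prob_kernelD:
  assumes "prob_kernel K"
  shows "kmap K \<in> tspace (kdom K) \<rightarrow>\<^sub>M prob_algebra (tspace (kcod K))"
    and "kmap K \<in> tspace (kdom K) \<rightarrow>\<^sub>M subprob_algebra (tspace (kcod K))"
  using assms by (auto simp: prob_kernel_def intro: measurable_prob_algebraD)

lemma space_kmap:
  "prob_kernel K \<Longrightarrow> s \<in> space (tspace (kdom K)) \<Longrightarrow>
    sets (kmap K s) = sets (tspace (kcod K)) \<and> space (kmap K s) = space (tspace (kcod K)) \<and>
    prob_space (kmap K s)"
  by (metis (mono_tags, lifting) mem_Collect_eq measurable_space prob_kernelD(1)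
      sets_eq_imp_space_eq space_prob_algebra)

lemma sprod_kernel_measurable:
  assumes "\<nu> \<in> tspace As \<rightarrow>\<^sub>M prob_algebra (tspace Bs)"
  shows "(\<lambda>t. distr (\<nu> t) (tspace (As @ Bs)) (tcat (length As) (length Bs) t))
           \<in> tspace As \<rightarrow>\<^sub>M prob_algebra (tspace (As @ Bs))"
  using measurable_tcat[OF measurable_fst measurable_snd refl refl, of As Bs]
  by (intro measurable_distr_prob_space2[OF assms]) (simp add: case_prod_beta)

lemma measurable_tcat_Pair:
  assumes "t \<in> space (tspace As)"
  shows "tcat (length As) (length Bs) t \<in> tspace Bs \<rightarrow>\<^sub>M tspace (As @ Bs)"
  using measurable_tcat[OF measurable_const[OF assms] measurable_ident_sets[OF refl] refl refl] by simp

lemma sets_bind_prob: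
  assumes "sets \<mu> = sets M" "prob_space \<mu>" "\<nu> \<in> M \<rightarrow>\<^sub>M prob_algebra N"
  shows "sets (bind \<mu> \<nu>) = sets N" "prob_space (bind \<mu> \<nu>)"
proof -
  have \<nu>: "\<nu> \<in> \<mu> \<rightarrow>\<^sub>M prob_algebra N"
    using assms measurable_cong_sets by blast
  have "\<mu> \<in> space (prob_algebra \<mu>)"
    using assms(2) by (simp add: space_prob_algebra)
  \<comment> \<open>The measure \<open>\<mu>\<close> is read as a constant kernel, so that
    measurability of \<open>bind\<close> into \<open>prob_algebra\<close>, evaluated at one point,
    yields both claims.\<close>
  from measurable_space[OF measurable_bind_prob_space[OF measurable_const[OF this] \<nu>], of undefined "count_space UNIV"]
  show "sets (bind \<mu> \<nu>) = sets N" "prob_space (bind \<mu> \<nu>)"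
    by (auto simp: space_prob_algebra)
qed

lemma sets_sprod:
  assumes "sets \<mu> = sets (tspace As)" "prob_space \<mu>"
    "\<nu> \<in> tspace As \<rightarrow>\<^sub>M prob_algebra (tspace Bs)"
  shows "sets (sprod As Bs \<mu> \<nu>) = sets (tspace (As @ Bs))" "prob_space (sprod As Bs \<mu> \<nu>)"
  unfolding sprod_def using sets_bind_prob[OF assms(1,2) sprod_kernel_measurable[OF assms(3)]] .

text \<open>Fubini for the product of a measure with a kernel. Measurability of the inner integral
  is a separate conclusion because iterated products integrate it again.\<close>

lemma nn_integral_sprod:
  assumes \<mu>: "sets \<mu> = sets (tspace As)"
    and \<nu>: "\<nu> \<in> tspace As \<rightarrow>\<^sub>M prob_algebra (tspace Bs)"
    and h: "h \<in> borel_measurable (tspace (As @ Bs))"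
  shows "(\<integral>\<^sup>+x. h x \<partial>sprod As Bs \<mu> \<nu>) =
      (\<integral>\<^sup>+t. \<integral>\<^sup>+u. h (tcat (length As) (length Bs) t u) \<partial>\<nu> t \<partial>\<mu>)" (is ?eq)
    and "(\<lambda>t. \<integral>\<^sup>+u. h (tcat (length As) (length Bs) t u) \<partial>\<nu> t) \<in> borel_measurable (tspace As)"
      (is ?meas)
proof -
  let ?k = "\<lambda>t. distr (\<nu> t) (tspace (As @ Bs)) (tcat (length As) (length Bs) t)"
  have k: "?k \<in> \<mu> \<rightarrow>\<^sub>M subprob_algebra (tspace (As @ Bs))"
    using measurable_prob_algebraD[OF sprod_kernel_measurable[OF \<nu>]] \<mu> measurable_cong_sets by blast
  have d: "(\<integral>\<^sup>+x. h x \<partial>?k t) = (\<integral>\<^sup>+u. h (tcat (length As) (length Bs) t u) \<partial>\<nu> t)"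
    if t: "t \<in> space (tspace As)" for t
  proof (rule nn_integral_distr)
    show "h \<in> borel_measurable (distr (\<nu> t) (tspace (As @ Bs)) (tcat (length As) (length Bs) t))"
      using h by simp
    have "sets (\<nu> t) = sets (tspace Bs)"
      using measurable_space[OF \<nu> t] by (simp add: space_prob_algebra)
    then show "tcat (length As) (length Bs) t \<in> \<nu> t \<rightarrow>\<^sub>M tspace (As @ Bs)"
      using measurable_tcat_Pair[OF t] measurable_cong_sets by blast
  qed
  show ?eq
    unfolding sprod_def nn_integral_bind[OF h k]
    by (rule nn_integral_cong) (use d \<mu> sets_eq_imp_space_eq in blast)
  have "(\<lambda>t. \<integral>\<^sup>+x. h x \<partial>?k t) \<in> borel_measurable (tspace As)"
    using measurable_compose[OF measurable_prob_algebraD[OF sprod_kernel_measurable[OF \<nu>]]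
        nn_integral_measurable_subprob_algebra[OF h]] .
  then show ?meas
    using d by (simp cong: measurable_cong)
qed

lemma prob_kernel_kregard:
  assumes K: "prob_kernel K" and r: "regardable As ws Bs K"
  shows "prob_kernel (kregard As ws Bs K)"
proof -
  have "(\<lambda>s. kmap K (tpick ws s)) \<in> tspace As \<rightarrow>\<^sub>M prob_algebra (tspace (kcod K))"
    using measurable_compose[OF measurable_tpick_regardable[OF r] prob_kernelD(1)[OF K]] .
  moreover have "(\<lambda>t. t) \<in> tspace (kcod K) \<rightarrow>\<^sub>M tspace Bs"
    using r measurable_tspace_meas_subspace[OF _ measurable_ident_sets[OF refl]] by (auto simp: regardable_def)
  ultimately have "(\<lambda>s. distr (kmap K (tpick ws s)) (tspace Bs) (\<lambda>t. t))
      \<in> tspace As \<rightarrow>\<^sub>M prob_algebra (tspace Bs)"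
    by (rule measurable_compose[OF _ measurable_distr_prob_space])
  then show ?thesis
    using r by (auto simp: prob_kernel_def kregard_def regardable_def)
qed

lemma nn_integral_kregard:
  assumes K: "prob_kernel K" and r: "regardable As ws Bs K" and s: "s \<in> space (tspace As)"
    and h: "h \<in> borel_measurable (tspace Bs)"
  shows "(\<integral>\<^sup>+x. h x \<partial>kmap (kregard As ws Bs K) s) = (\<integral>\<^sup>+x. h x \<partial>kmap K (tpick ws s))"
proof -
  have "(\<lambda>t. t) \<in> tspace (kcod K) \<rightarrow>\<^sub>M tspace Bs"
    using r measurable_tspace_meas_subspace[OF _ measurable_ident_sets[OF refl]] by (auto simp: regardable_def)
  then have "(\<lambda>t. t) \<in> kmap K (tpick ws s) \<rightarrow>\<^sub>M tspace Bs"
    using space_kmap[OF K measurable_space[OF measurable_tpick_regardable[OF r] s]]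
      measurable_cong_sets by blast
  from nn_integral_distr[OF this, of h] h show ?thesis by (simp add: kregard_def)
qed

lemma prob_kernel_kselect:
  assumes K: "prob_kernel K" and js: "set js \<subseteq> {..<length (kcod K)}"
  shows "prob_kernel (kselect js K)"
proof -
  have "(\<lambda>s. distr (kmap K s) (tspace (map (\<lambda>j. kcod K ! j) js)) (tpick js))
      \<in> tspace (kdom K) \<rightarrow>\<^sub>M prob_algebra (tspace (map (\<lambda>j. kcod K ! j) js))"
    by (rule measurable_compose[OF prob_kernelD(1)[OF K]
          measurable_distr_prob_space[OF measurable_tpick_tspace[OF js]]])
  then show ?thesis
    using K js by (auto simp: prob_kernel_def kselect_def)
qed

lemma nn_integral_kselect:
  assumes K: "prob_kernel K" and js: "set js \<subseteq> {..<length (kcod K)}"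
    and s: "s \<in> space (tspace (kdom K))"
    and h: "h \<in> borel_measurable (tspace (map (\<lambda>j. kcod K ! j) js))"
  shows "(\<integral>\<^sup>+x. h x \<partial>kmap (kselect js K) s) = (\<integral>\<^sup>+x. h (tpick js x) \<partial>kmap K s)"
proof -
  have "tpick js \<in> kmap K s \<rightarrow>\<^sub>M tspace (map (\<lambda>j. kcod K ! j) js)"
    using measurable_tpick_tspace[OF js] space_kmap[OF K s] measurable_cong_sets by blast
  from nn_integral_distr[OF this, of h] h show ?thesis by (simp add: kselect_def)
qed

lemma prob_kernel_kprod:
  assumes \<mu>: "prob_kernel \<mu>" and \<nu>: "prob_kernel \<nu>" and d: "kdom \<nu> = kdom \<mu> @ kcod \<mu>"
  shows "prob_kernel (kprod \<mu> \<nu>)"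
    and "s \<in> space (tspace (kdom \<mu>)) \<Longrightarrow>
      (\<lambda>t. kmap \<nu> (tcat (length (kdom \<mu>)) (length (kcod \<mu>)) s t))
        \<in> tspace (kcod \<mu>) \<rightarrow>\<^sub>M prob_algebra (tspace (kcod \<nu>))"
proof -
  \<comment> \<open>Joint measurability in \<open>s\<close> and \<open>t\<close> serves both claims:
    its sections give the second one, and binding over \<open>t\<close> with \<open>s\<close> as
    parameter gives the first.\<close>
  have *: "(\<lambda>(s, t). kmap \<nu> (tcat (length (kdom \<mu>)) (length (kcod \<mu>)) s t))
      \<in> tspace (kdom \<mu>) \<Otimes>\<^sub>M tspace (kcod \<mu>) \<rightarrow>\<^sub>M prob_algebra (tspace (kcod \<nu>))"
    using measurable_compose[OF measurable_tcat[OF measurable_fst measurable_snd refl refl]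
        prob_kernelD(1)[OF \<nu>, unfolded d]] by (simp add: case_prod_beta)
  show "(\<lambda>t. kmap \<nu> (tcat (length (kdom \<mu>)) (length (kcod \<mu>)) s t))
        \<in> tspace (kcod \<mu>) \<rightarrow>\<^sub>M prob_algebra (tspace (kcod \<nu>))" if "s \<in> space (tspace (kdom \<mu>))"
    using measurable_compose[OF measurable_Pair1'[OF that] *] by simp
  have t: "(\<lambda>x. tcat (length (kcod \<mu>)) (length (kcod \<nu>)) (snd (fst x)) (snd x))
      \<in> (tspace (kdom \<mu>) \<Otimes>\<^sub>M tspace (kcod \<mu>)) \<Otimes>\<^sub>M tspace (kcod \<nu>) \<rightarrow>\<^sub>M tspace (kcod \<mu> @ kcod \<nu>)"
    by (intro measurable_tcat refl measurable_snd measurable_compose[OF measurable_fst measurable_snd])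
  have "(\<lambda>x. distr (kmap \<nu> (tcat (length (kdom \<mu>)) (length (kcod \<mu>)) (fst x) (snd x)))
       (tspace (kcod \<mu> @ kcod \<nu>)) (tcat (length (kcod \<mu>)) (length (kcod \<nu>)) (snd x)))
      \<in> tspace (kdom \<mu>) \<Otimes>\<^sub>M tspace (kcod \<mu>) \<rightarrow>\<^sub>M prob_algebra (tspace (kcod \<mu> @ kcod \<nu>))"
    using * t by (intro measurable_distr_prob_space2[where M = "tspace (kcod \<nu>)"])
      (simp_all add: case_prod_beta)
  then have "kmap (kprod \<mu> \<nu>)
      \<in> tspace (kdom \<mu>) \<rightarrow>\<^sub>M prob_algebra (tspace (kcod \<mu> @ kcod \<nu>))"
    unfolding kprod_def sprod_def kernel.simps
    by (intro measurable_bind_prob_space2[OF prob_kernelD(1)[OF \<mu>]]) (simp add: case_prod_beta)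
  then show "prob_kernel (kprod \<mu> \<nu>)"
    using \<mu> \<nu> by (auto simp: prob_kernel_def kprod_def)
qed

section \<open>Wired products as iterated integrals\<close>

text \<open>Integrating over environments \<open>v\<close> instead of tuples makes the bookkeeping of argument positions
  disappear: the iterated integral does not depend on the list of nodes whose values are
  arguments, so a product can be split and its nodes can be renamed freely.\<close>

primrec wired_int ::
  "('n \<Rightarrow> 'v kernel) \<Rightarrow> ('n \<Rightarrow> 'n list) \<Rightarrow> 'n list \<Rightarrow> ('n \<Rightarrow> 'v) \<Rightarrow> (('n \<Rightarrow> 'v) \<Rightarrow> ennreal) \<Rightarrow> ennreal"
where
  "wired_int f pa [] v h = h v"
| "wired_int f pa (n # ns) v h =
     (\<integral>\<^sup>+x. wired_int f pa ns (v(n := x 0)) h \<partial>kmap (f n) (tpick (pa n) v))"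

text \<open>The target of the kernel is only asked to be a subspace of \<open>val n\<close>. This
  covers the graph, where both have the same sets, as well as the model, where a mechanism may map
  into a smaller space.\<close>

definition node_ok ::
  "('n \<Rightarrow> 'v kernel) \<Rightarrow> ('n \<Rightarrow> 'n list) \<Rightarrow> ('n \<Rightarrow> 'v measure) \<Rightarrow> 'n \<Rightarrow> bool"
where
  "node_ok f pa val n \<longleftrightarrow>
     prob_kernel (f n) \<and> standard_borel (val n) \<and> distinct (pa n) \<and>
     list_all2 meas_subspace (map val (pa n)) (kdom (f n)) \<and>
     list_all2 meas_subspace (kcod (f n)) [val n]"

text \<open>The list \<open>os\<close> is a growing context of nodes with known values. Freshness of
  \<open>n\<close> ensures that the update in \<open>wired_int\<close> never overwrites a value
  already assigned.\<close>

primrec wired_ok ::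
  "('n \<Rightarrow> 'v kernel) \<Rightarrow> ('n \<Rightarrow> 'n list) \<Rightarrow> ('n \<Rightarrow> 'v measure) \<Rightarrow> 'n list \<Rightarrow> 'n list \<Rightarrow> bool"
where
  "wired_ok f pa val os [] \<longleftrightarrow> True"
| "wired_ok f pa val os (n # ns) \<longleftrightarrow>
     n \<notin> set os \<and> node_ok f pa val n \<and> set (pa n) \<subseteq> set os \<and> wired_ok f pa val (os @ [n]) ns"

declare node_ok_def [simp]

lemma wired_ok_disjoint: "wired_ok f pa val os ns \<Longrightarrow> set ns \<inter> set os = {}"
proof (induction ns arbitrary: os)
  case (Cons n ns)
  then have "set ns \<inter> set (os @ [n]) = {}" by (simp only: wired_ok.simps)
  with Cons.prems show ?case by auto
qed simp

section \<open>Causal orders\<close>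

lemma wired_okI:
  assumes "\<And>n. n \<in> set ns \<Longrightarrow> node_ok f pa val n" "distinct (os @ ns)"
    and "\<And>b. b < length ns \<Longrightarrow> set (pa (ns ! b)) \<subseteq> set os \<union> set (take b ns)"
  shows "wired_ok f pa val os ns"
  using assms
proof (induction ns arbitrary: os)
  case (Cons n ns)
  have "wired_ok f pa val (os @ [n]) ns"
  proof (rule Cons.IH)
    show "set (pa (ns ! b)) \<subseteq> set (os @ [n]) \<union> set (take b ns)" if "b < length ns" for b
      using Cons.prems(3)[of "Suc b"] that by auto
  qed (use Cons.prems in auto)
  then show ?case using Cons.prems(1)[of n] Cons.prems(2) Cons.prems(3)[of 0] by auto
qed simp

lemma wired_ok_causal_order:
  assumes ns: "causal_order E A ns" and "acyclic E" and "distinct os" "set os \<inter> A = {}"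
    and ok: "\<And>n. n \<in> A \<Longrightarrow> node_ok f pa val n"
    and pa: "\<And>n. n \<in> A \<Longrightarrow> set (pa n) \<subseteq> set os \<union> A"
    and E: "\<And>m n. n \<in> A \<Longrightarrow> m \<in> set (pa n) \<Longrightarrow> (m, n) \<in> E"
  shows "wired_ok f pa val os ns"
proof (rule wired_okI)
  have A: "set ns = A" "distinct ns" using ns by (auto simp: causal_order_def)
  then show "node_ok f pa val n" if "n \<in> set ns" for n using ok that by simp
  show "distinct (os @ ns)" using A assms by auto
  fix b assume b: "b < length ns"
  then have bA: "ns ! b \<in> A" using A by auto
  show "set (pa (ns ! b)) \<subseteq> set os \<union> set (take b ns)"
  proof
    fix m assume m: "m \<in> set (pa (ns ! b))"
    show "m \<in> set os \<union> set (take b ns)"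
    proof (cases "m \<in> set os")
      case False
      then have "m \<in> set ns" using pa[OF bA] m A by auto
      then obtain a where a: "a < length ns" "ns ! a = m" by (auto simp: in_set_conv_nth)
      have "(ns ! a, ns ! b) \<in> E" using E[OF bA m] a by simp
      \<comment> \<open>A causal order only rules out edges from later to earlier positions; the
        case \<open>a = b\<close> would be a loop and contradicts acyclicity.\<close>
      then have "\<not> b < a" "a \<noteq> b"
        using ns a b \<open>acyclic E\<close> by (auto simp: causal_order_def acyclic_def)
      then have "a < b" by simp
      then show ?thesis using a by (auto simp: in_set_conv_nth intro!: exI[of _ a])
    qed simp
  qed
qed

text \<open>Induction by removing a sink of \<open>A\<close> and placing it last. The relation
  \<open>E\<close> may be infinite, so the sink is found in its finite restriction to
  \<open>A\<close>.\<close>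

lemma causal_order_exists:
  assumes "finite A" "acyclic E"
  shows "\<exists>is. causal_order E A is"
  using assms(1)
proof (induction A rule: finite_psubset_induct)
  case (psubset A)
  show ?case
  proof (cases "A = {}")
    case False
    have "finite (E \<inter> A \<times> A)" using psubset.hyps by simp
    moreover have "acyclic (E \<inter> A \<times> A)" using assms(2) by (rule acyclic_subset) simp
    ultimately have "wf ((E \<inter> A \<times> A)\<inverse>)" by (rule finite_acyclic_wf_converse)
    then have "\<exists>n\<in>A. \<forall>m. (m, n) \<in> (E \<inter> A \<times> A)\<inverse> \<longrightarrow> m \<notin> A"
      using False unfolding wf_eq_minimal by blast
    then obtain n where n: "n \<in> A" and sink: "\<And>m. m \<in> A \<Longrightarrow> (n, m) \<notin> E" by auto
    obtain ms where ms: "causal_order E (A - {n}) ms"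
      using psubset.IH[of "A - {n}"] n by auto
    then have "causal_order E A (ms @ [n])"
      using n(1) sink nth_mem[of _ ms] by (auto simp: causal_order_def nth_append)
    then show ?thesis ..
  qed (auto simp: causal_order_def)
qed

section \<open>Integrals against wired products\<close>

lemma wired_ok_regardable:
  assumes "wired_ok f pa val os (n # ns)" "\<forall>m \<in> set os. standard_borel (val m)"
  shows "regardable (map val os) (map (position os) (pa n)) [val n] (f n)"
proof -
  have "inj_on (position os) (set (pa n))"
    using assms nth_position[of _ os] by (intro inj_onI) (metis subsetD wired_ok.simps(2))
  moreover have "map (\<lambda>w. map val os ! w) (map (position os) (pa n)) = map val (pa n)"
    using assms by (auto simp: position_less nth_position subset_iff)
  moreover have "distinct (pa n)" "list_all2 meas_subspace (map val (pa n)) (kdom (f n))"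
    using assms(1) by simp_all
  ultimately have "distinct (map (position os) (pa n)) \<and>
      list_all2 meas_subspace (map (\<lambda>w. map val os ! w) (map (position os) (pa n))) (kdom (f n))"
    by (simp only: distinct_map)
  then show ?thesis
    using assms unfolding regardable_def by (auto simp: subset_iff position_less)
qed

lemma wired_product_kernel:
  assumes "wired_ok f pa val os ns" "\<forall>m \<in> set os. standard_borel (val m)"
  shows "prob_kernel (wired_product f pa val os ns) \<and>
    kdom (wired_product f pa val os ns) = map val os \<and>
    kcod (wired_product f pa val os ns) = map val ns"
  using assms
proof (induction ns arbitrary: os)
  case Nil
  have "return (tspace []) (\<lambda>_. undefined) \<in> space (prob_algebra (tspace []))"
    by (auto simp: space_prob_algebra space_tspace intro!: prob_space_return)
  with Nil show ?case by (auto simp: prob_kernel_def intro: measurable_const)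
next
  case (Cons n ns)
  then have IH: "prob_kernel (wired_product f pa val (os @ [n]) ns) \<and>
    kdom (wired_product f pa val (os @ [n]) ns) = map val (os @ [n]) \<and>
    kcod (wired_product f pa val (os @ [n]) ns) = map val ns" by auto
  have "prob_kernel (kregard (map val os) (map (position os) (pa n)) [val n] (f n))"
    using Cons.prems by (intro prob_kernel_kregard wired_ok_regardable) auto
  from prob_kernel_kprod(1)[OF this, of "wired_product f pa val (os @ [n]) ns"] IH
  show ?case by (auto simp: kregard_def kprod_def)
qed

text \<open>The integrands are compared only on environments that the iterated integral can reach:
  values lie in the right spaces and differ from \<open>v\<close> only at \<open>ns\<close>. Hence
  anything read off at earlier nodes may be treated as a constant.\<close>

lemma wired_int_cong:
  assumes "wired_ok f pa val os ns" "\<forall>m \<in> set os. v m \<in> space (val m)"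
    and "\<And>w. (\<forall>m \<in> set os \<union> set ns. w m \<in> space (val m)) \<Longrightarrow> (\<forall>m. m \<notin> set ns \<longrightarrow> w m = v m) \<Longrightarrow>
           h w = h' w"
  shows "wired_int f pa ns v h = wired_int f pa ns v h'"
  using assms
proof (induction ns arbitrary: os v)
  case (Cons n ns)
  have s: "tpick (pa n) v \<in> space (tspace (map val (pa n)))"
    using Cons.prems by (intro tpick_in_tspace) auto
  have "tpick (pa n) v \<in> space (tspace (kdom (f n)))"
    using measurable_space[OF measurable_tspace_meas_subspace[OF _ measurable_ident_sets[OF refl]] s] Cons.prems
    by auto
  then have sp: "space (kmap (f n) (tpick (pa n) v)) = space (tspace (kcod (f n)))"
    using space_kmap Cons.prems by auto
  have "wired_int f pa ns (v(n := x 0)) h = wired_int f pa ns (v(n := x 0)) h'"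
    if x: "x \<in> space (kmap (f n) (tpick (pa n) v))" for x
  proof (rule Cons.IH)
    have "x 0 \<in> space (val n)"
      using x Cons.prems(1) unfolding sp
      by (auto simp: space_tspace list_all2_Cons2 meas_subspace_def PiE_def Pi_def)
    then show "\<forall>m\<in>set (os @ [n]). (v(n := x 0)) m \<in> space (val m)"
      using Cons.prems by auto
    show "wired_ok f pa val (os @ [n]) ns" using Cons.prems by auto
    fix w assume "\<forall>m\<in>set (os @ [n]) \<union> set ns. w m \<in> space (val m)"
      "\<forall>m. m \<notin> set ns \<longrightarrow> w m = (v(n := x 0)) m"
    then show "h w = h' w"
      by (intro Cons.prems(3)) auto
  qed
  then show ?case by (auto intro!: nn_integral_cong)
qed simp

text \<open>Translates the positional definition into environments. Each step peels off the first
  kernel by Fubini and moves its node from \<open>ns\<close> to the context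
  \<open>os\<close>.\<close>

lemma nn_integral_wired_product:
  assumes "wired_ok f pa val os ns" "\<forall>m \<in> set os. standard_borel (val m)"
    and "\<forall>m \<in> set os. v m \<in> space (val m)"
    and "h \<in> borel_measurable (tspace (map val ns))"
  shows "(\<integral>\<^sup>+u. h u \<partial>kmap (wired_product f pa val os ns) (tpick os v)) =
    wired_int f pa ns v (\<lambda>w. h (tpick ns w))"
  using assms
proof (induction ns arbitrary: os v h)
  case Nil
  have "tpick [] v = (\<lambda>_. undefined)" for v :: "'a \<Rightarrow> 'b" by (auto simp: tpick_def)
  with Nil show ?case
    by (auto simp: nn_integral_return space_tspace)
next
  case (Cons n ns)
  let ?\<mu> = "kregard (map val os) (map (position os) (pa n)) [val n] (f n)"
  let ?\<nu> = "wired_product f pa val (os @ [n]) ns"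
  have ok: "wired_ok f pa val (os @ [n]) ns" "\<forall>m \<in> set (os @ [n]). standard_borel (val m)"
    and n: "n \<notin> set os" "n \<notin> set ns" and K: "prob_kernel (f n)" and pa: "set (pa n) \<subseteq> set os"
    and cod: "list_all2 meas_subspace (kcod (f n)) [val n]"
    using Cons.prems wired_ok_disjoint[of f pa val "os @ [n]" ns] by auto
  have r: "regardable (map val os) (map (position os) (pa n)) [val n] (f n)"
    using Cons.prems by (intro wired_ok_regardable)
  have \<mu>: "prob_kernel ?\<mu>" "kdom ?\<mu> = map val os" "kcod ?\<mu> = [val n]"
    using prob_kernel_kregard[OF K r] by (auto simp: kregard_def)
  have \<nu>: "prob_kernel ?\<nu>" "kdom ?\<nu> = kdom ?\<mu> @ kcod ?\<mu>" "kcod ?\<nu> = map val ns"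
    using wired_product_kernel[OF ok] \<mu> by auto
  let ?s = "tpick os v"
  let ?k = "\<lambda>t. kmap ?\<nu> (tcat (length os) 1 ?s t)"
  have s: "?s \<in> space (tspace (map val os))"
    using Cons.prems by (intro tpick_in_tspace) auto
  have k: "?k \<in> tspace [val n] \<rightarrow>\<^sub>M prob_algebra (tspace (map val ns))"
    using prob_kernel_kprod(2)[OF \<mu>(1) \<nu>(1,2), of ?s] s \<mu> \<nu> by simp
  have sets_\<mu>: "sets (kmap ?\<mu> ?s) = sets (tspace [val n])"
    using space_kmap[OF \<mu>(1), of ?s] \<mu> s by simp
  have h: "h \<in> borel_measurable (tspace ([val n] @ map val ns))"
    using Cons.prems by simp
  have pa': "tpick (map (position os) (pa n)) ?s = tpick (pa n) v"
    using pa by (rule tpick_position)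
  have sp: "space (kmap (f n) (tpick (pa n) v)) = space (tspace (kcod (f n)))"
    using space_kmap[OF K measurable_space[OF measurable_tpick_regardable[OF r] s]] pa' by simp
  have "(\<integral>\<^sup>+u. h u \<partial>kmap (wired_product f pa val os (n # ns)) ?s) =
      (\<integral>\<^sup>+u. h u \<partial>sprod [val n] (map val ns) (kmap ?\<mu> ?s) ?k)"
    using \<mu> \<nu> by (simp add: kprod_def)
  also have "\<dots> = (\<integral>\<^sup>+t. \<integral>\<^sup>+u. h (tcat 1 (length ns) t u) \<partial>?k t \<partial>kmap ?\<mu> ?s)"
    using nn_integral_sprod(1)[OF sets_\<mu> k h] by simp
  also have "\<dots> = (\<integral>\<^sup>+t. \<integral>\<^sup>+u. h (tcat 1 (length ns) t u) \<partial>?k t \<partial>kmap (f n) (tpick (pa n) v))"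
    using nn_integral_kregard[OF K r s nn_integral_sprod(2)[OF sets_\<mu> k h]] pa' by simp
  also have "\<dots> = (\<integral>\<^sup>+t. wired_int f pa ns (v(n := t 0)) (\<lambda>w. h (tpick (n # ns) w))
      \<partial>kmap (f n) (tpick (pa n) v))"
  proof (rule nn_integral_cong)
    fix t assume "t \<in> space (kmap (f n) (tpick (pa n) v))"
    then have t': "t \<in> space (tspace (kcod (f n)))" using sp by simp
    have t: "t \<in> space (tspace [val n])"
      using measurable_space[OF measurable_tspace_meas_subspace[OF cod measurable_ident_sets[OF refl]] t'] by simp
    let ?v = "v(n := t 0)"
    have v: "\<forall>m\<in>set (os @ [n]). ?v m \<in> space (val m)"
      using measurable_space[OF tspace_component t, of 0] Cons.prems(3) by auto
    \<comment> \<open>The first kernel has a single target factor, so the tuple \<open>t\<close>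
      carries no more information than the value \<open>t 0\<close> stored at
      \<open>n\<close>.\<close>
    have t_eq: "t = tpick [n] ?v"
      using t by (auto simp: tpick_def space_tspace PiE_def extensional_def fun_eq_iff)
    have "tpick os v = tpick os ?v" using n by (intro tpick_cong) auto
    then have arg: "tcat (length os) 1 ?s t = tpick (os @ [n]) ?v"
      using tcat_tpick[of os "[n]" ?v] t_eq by simp
    have h': "(\<lambda>u. h (tcat 1 (length ns) t u)) \<in> borel_measurable (tspace (map val ns))"
      using measurable_compose[OF measurable_tcat_Pair[OF t, of "map val ns"] h] by simp
    have "(\<integral>\<^sup>+u. h (tcat 1 (length ns) t u) \<partial>?k t) =
        wired_int f pa ns ?v (\<lambda>w. h (tcat 1 (length ns) t (tpick ns w)))"
      unfolding arg by (rule Cons.IH[OF ok v h'])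
    also have "\<dots> = wired_int f pa ns ?v (\<lambda>w. h (tpick (n # ns) w))"
    \<comment> \<open>Integrating over \<open>ns\<close> leaves the value at \<open>n\<close>
      untouched, so the fixed tuple \<open>t\<close> can be recovered from every reachable
      \<open>w\<close>.\<close>
    proof (rule wired_int_cong[OF ok(1) v])
      fix w assume "\<forall>m. m \<notin> set ns \<longrightarrow> w m = ?v m"
      then have "tpick [n] w = tpick [n] ?v"
        using n by (intro tpick_cong) simp
      then have "t = tpick [n] w"
        using t_eq by simp
      then show "h (tcat 1 (length ns) t (tpick ns w)) = h (tpick (n # ns) w)"
        using tcat_tpick[of "[n]" ns w] by simp
    qed
    finally show "(\<integral>\<^sup>+u. h (tcat 1 (length ns) t u) \<partial>?k t) =
        wired_int f pa ns ?v (\<lambda>w. h (tpick (n # ns) w))" .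
  qed
  finally show ?case by simp
qed

lemma wired_int_append:
  "wired_int f pa (ms @ ns) v h = wired_int f pa ms v (\<lambda>w. wired_int f pa ns w h)"
  by (induction ms arbitrary: v) auto

lemma wired_int_zero: "wired_int f pa ns v (\<lambda>_. 0) = 0"
  by (induction ns arbitrary: v) auto

text \<open>Environments over graph nodes are matched with environments over model indices along
  \<open>\<psi>\<close>. Injectivity guarantees that updating \<open>\<psi> n\<close> changes the
  value of no other node of \<open>N\<close>.\<close>

lemma wired_int_relabel:
  assumes "inj_on \<psi> N" "set ns \<subseteq> N"
    and "\<And>n. n \<in> set ns \<Longrightarrow> f n = f' (\<psi> n) \<and> map \<psi> (pa n) = pa' (\<psi> n) \<and> set (pa n) \<subseteq> N"
    and "\<And>m. m \<in> N \<Longrightarrow> u m = v (\<psi> m)"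
    and "\<And>w w'. (\<And>m. m \<in> N \<Longrightarrow> w m = w' (\<psi> m)) \<Longrightarrow> h w = h' w'"
  shows "wired_int f pa ns u h = wired_int f' pa' (map \<psi> ns) v h'"
  using assms
proof (induction ns arbitrary: u v)
  case (Cons n ns)
  have "tpick (pa n) u = tpick (map \<psi> (pa n)) v"
    using Cons.prems(3)[of n, THEN conjunct2, THEN conjunct2] Cons.prems(4)
    by (auto simp: tpick_def fun_eq_iff subset_iff)
  moreover have "wired_int f pa ns (u(n := x 0)) h = wired_int f' pa' (map \<psi> ns) (v(\<psi> n := x 0)) h'"
    for x :: "nat \<Rightarrow> _"
    using Cons.prems by (intro Cons.IH) (auto simp: inj_on_def)
  ultimately show ?case using Cons.prems(3)[of n] by simp
qed auto

section \<open>Models\<close>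

lemma region_of:
  assumes "causal_model M" "i \<in> m_idx M"
  shows "region_of M i \<in> m_regions M" "i \<in> region_of M i"
proof -
  have p: "partition_on (m_idx M) (m_regions M)" using assms by (simp add: causal_model_def)
  then obtain J where J: "J \<in> m_regions M" "i \<in> J"
    using assms(2) by (auto simp: partition_on_def)
  have "region_of M i = J"
    unfolding region_of_def
  proof (rule the_equality)
    show "J' = J" if "J' \<in> m_regions M \<and> i \<in> J'" for J'
      using p J that by (auto simp: partition_on_def disjoint_def)
  qed (use J in simp)
  then show "region_of M i \<in> m_regions M" "i \<in> region_of M i" using J by auto
qed

lemma node_ok_model:
  assumes "causal_model M" "i \<in> m_idx M"
  shows "node_ok (mech_at M) (par_at M) (m_val M) i" and "set (par_at M i) \<subseteq> m_idx M"
proof -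
  have "mechanism M (region_of M i)"
    using assms region_of[OF assms] by (auto simp: causal_model_def)
  then have *: "prob_kernel (mech_at M i)" "length (kcod (mech_at M i)) = 1"
    "set (par_at M i) \<subseteq> m_idx M" "distinct (par_at M i)"
    "list_all2 meas_subspace (map (m_val M) (par_at M i)) (kdom (mech_at M i))"
    "meas_subspace (kcod (mech_at M i) ! 0) (m_val M i)"
    using region_of[OF assms] by (auto simp: mechanism_def mech_at_def par_at_def)
  show "set (par_at M i) \<subseteq> m_idx M" by fact
  show "node_ok (mech_at M) (par_at M) (m_val M) i"
    using * assms by (auto simp: list_all2_conv_all_nth causal_model_def)
qed

lemma iedges_subset:
  "causal_model M \<Longrightarrow> iedges M \<subseteq> m_idx M \<times> m_idx M"
  using node_ok_model(2)[of M] by (auto simp: iedges_def)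

text \<open>The defining property of the shallow distribution for integrands that read only the
  coordinates in \<open>A\<close>. The start environment \<open>v0\<close> is arbitrary: each of its
  values at \<open>A\<close> is overwritten before it is read.\<close>

lemma nn_integral_shallow:
  assumes M: "causal_model M" "acyclic (iedges M)" and P: "shallow_distribution M P"
    and A: "finite A" "A \<subseteq> m_idx M" "\<And>i. i \<in> A \<Longrightarrow> set (par_at M i) \<subseteq> A"
    and "is": "causal_order (iedges M) A is"
    and g: "g \<in> borel_measurable (PiM A (m_val M))" "\<And>v. g (restrict v A) = g v"
  shows "(\<integral>\<^sup>+v. g v \<partial>P) = wired_int (mech_at M) (par_at M) is v0 g"
proof -
  \<comment> \<open>\<open>?h\<close> reads \<open>g\<close> off a tuple along \<open>is\<close> by
    rebuilding the environment on \<open>A\<close> from positions.\<close>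
  let ?h = "\<lambda>u. g (\<lambda>i\<in>A. u (position is i))"
  have set_is: "set is = A" using "is" by (simp add: causal_order_def)
  have ok: "wired_ok (mech_at M) (par_at M) (m_val M) [] is"
    using node_ok_model(1)[OF M(1)] A
    by (intro wired_ok_causal_order[OF "is" M(2)]) (auto simp: iedges_def simp del: node_ok_def)
  have h: "?h \<in> borel_measurable (tspace (map (m_val M) is))"
  proof (rule measurable_compose[OF _ g(1)], rule measurable_restrict)
    fix i assume "i \<in> A"
    then show "(\<lambda>u. u (position is i)) \<in> tspace (map (m_val M) is) \<rightarrow>\<^sub>M m_val M i"
      using tspace_component[of "position is i" "map (m_val M) is"] set_is
      by (simp add: position_less nth_position)
  qed
  have hg: "?h (tpick is v) = g v" for v
  proof -
    have "(\<lambda>i\<in>A. tpick is v (position is i)) = restrict v A"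
      using set_is by (auto simp: tpick_def fun_eq_iff position_less nth_position)
    then show ?thesis using g(2)[of v] by simp
  qed
  have sP: "sets P = sets (PiM (m_idx M) (m_val M))"
    using P by (simp add: shallow_distribution_def world_space_def)
  have t: "tpick is \<in> P \<rightarrow>\<^sub>M tspace (map (m_val M) is)"
    using measurable_tpick_PiM[of "is" "m_idx M" "m_val M"] A(2) set_is sP measurable_cong_sets by blast
  have "(\<integral>\<^sup>+v. g v \<partial>P) = (\<integral>\<^sup>+v. ?h (tpick is v) \<partial>P)" by (simp only: hg)
  also have "\<dots> = (\<integral>\<^sup>+u. ?h u \<partial>tuple_law M P is)"
    unfolding tuple_law_def using nn_integral_distr[OF t, of ?h] h by simp
  also have "tuple_law M P is =
      kmap (wired_product (mech_at M) (par_at M) (m_val M) [] is) (\<lambda>_. undefined)"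
    using P A "is" unfolding shallow_distribution_def by blast
  \<comment> \<open>The empty argument tuple is the restriction of any environment to no nodes; this
    is where \<open>v0\<close> enters freely.\<close>
  also have "(\<lambda>_. undefined) = tpick [] v0" by (auto simp: tpick_def)
  also have "(\<integral>\<^sup>+u. ?h u \<partial>kmap (wired_product (mech_at M) (par_at M) (m_val M) [] is) (tpick [] v0)) =
      wired_int (mech_at M) (par_at M) is v0 (\<lambda>w. ?h (tpick is w))"
    by (rule nn_integral_wired_product[OF ok _ _ h]) auto
  finally show ?thesis by (simp only: hg)
qed

section \<open>Conditional kernels\<close>

definition countably_generated :: "'a measure \<Rightarrow> bool" where
  "countably_generated M \<longleftrightarrow>
     (\<exists>G. countable G \<and> G \<subseteq> Pow (space M) \<and> sets M = sigma_sets (space M) G)"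

text \<open>Every open set is the union of the members of a countable base that it contains, so the
  base generates the Borel sets.\<close>

lemma countably_generated_standard_borel:
  assumes "standard_borel M"
  shows "countably_generated M"
proof -
  obtain T where T: "topspace T = space M" "second_countable T"
    "sets M = sigma_sets (topspace T) {U. openin T U}"
    using assms by (auto simp: standard_borel_def)
  obtain G where G: "countable G" "\<And>V. V \<in> G \<Longrightarrow> openin T V"
    "\<And>U x. openin T U \<Longrightarrow> x \<in> U \<Longrightarrow> \<exists>V\<in>G. x \<in> V \<and> V \<subseteq> U"
    using T(2) unfolding second_countable_def by auto
  have "sigma_sets (space M) {U. openin T U} = sigma_sets (space M) G"
  proof (rule sigma_sets_eqI)
    fix U assume "U \<in> {U. openin T U}"
    then have "U = \<Union>{V \<in> G. V \<subseteq> U}" using G(3) by blast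
    moreover have "\<Union>{V \<in> G. V \<subseteq> U} \<in> sigma_sets (space M) G"
      using G(1) by (intro sigma_sets_UNION) (auto intro: countable_subset sigma_sets.Basic)
    ultimately show "U \<in> sigma_sets (space M) G" by simp
  qed (use G in \<open>auto intro: sigma_sets.Basic\<close>)
  moreover have "G \<subseteq> Pow (space M)" using G(2) T(1) openin_subset by blast
  ultimately show ?thesis using T G(1) unfolding countably_generated_def by auto
qed

lemma countably_generated_PiM:
  assumes "countable I" "\<And>i. i \<in> I \<Longrightarrow> countably_generated (M i)"
  shows "countably_generated (PiM I M)"
proof -
  have "\<forall>i\<in>I. \<exists>G. countable G \<and> G \<subseteq> Pow (space (M i)) \<and> sets (M i) = sigma_sets (space (M i)) G"
    using assms(2) by (simp add: countably_generated_def)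
  from bchoice[OF this] obtain G where G': "\<forall>i\<in>I. countable (G i) \<and> G i \<subseteq> Pow (space (M i)) \<and>
    sets (M i) = sigma_sets (space (M i)) (G i)" ..
  then have G: "\<And>i. i \<in> I \<Longrightarrow> countable (G i)"
    "\<And>i. i \<in> I \<Longrightarrow> sets (M i) = sigma_sets (space (M i)) (G i)"
    by simp_all
  let ?S = "space (PiM I M)"
  let ?c = "\<lambda>i A. {f \<in> ?S. f i \<in> A}"
  let ?G = "\<Union>i\<in>I. ?c i ` G i"
  \<comment> \<open>Preimages under a coordinate commute with complements and countable unions, so
    cylinders over generators produce all one-coordinate cylinders.\<close>
  have c: "?c i A \<in> sigma_sets ?S ?G" if i: "i \<in> I" and A: "A \<in> sigma_sets (space (M i)) (G i)" for i A
    using A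
  proof induction
    case (Basic a)
    then show ?case using i by (intro sigma_sets.Basic) auto
  next
    case Empty
    then show ?case by (simp add: sigma_sets.Empty)
  next
    case (Compl a)
    have "?c i (space (M i) - a) = ?S - ?c i a" using i by (auto simp: space_PiM)
    then show ?case using Compl.IH by (simp add: sigma_sets.Compl)
  next
    case (Union a)
    have "?c i (\<Union>(range a)) = (\<Union>n. ?c i (a n))" by auto
    then show ?case using Union.IH by (simp add: sigma_sets.Union)
  qed
  have "sets (PiM I M) = sigma_sets ?S {?c i A |i A. i \<in> I \<and> A \<in> sets (M i)}"
    by (simp add: sets_PiM_single space_PiM)
  also have "\<dots> = sigma_sets ?S ?G"
  proof (rule sigma_sets_eqI)
    fix a assume "a \<in> {?c i A |i A. i \<in> I \<and> A \<in> sets (M i)}"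
    then obtain i A where "a = ?c i A" "i \<in> I" "A \<in> sigma_sets (space (M i)) (G i)"
      using G(2) by blast
    then show "a \<in> sigma_sets ?S ?G" using c by simp
  next
    fix a assume "a \<in> ?G"
    then obtain i A where "a = ?c i A" "i \<in> I" "A \<in> G i" by blast
    then have "a = ?c i A" "i \<in> I" "A \<in> sets (M i)"
      using G(2)[of i] by (simp_all add: sigma_sets.Basic)
    then show "a \<in> sigma_sets ?S {?c i A |i A. i \<in> I \<and> A \<in> sets (M i)}"
      by (intro sigma_sets.Basic) blast
  qed
  finally show ?thesis
    unfolding countably_generated_def using G(1) assms(1) by (intro exI[of _ ?G]) auto
qed

lemma countably_generated_tspace:
  "(\<And>A. A \<in> set As \<Longrightarrow> standard_borel A) \<Longrightarrow> countably_generated (tspace As)"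
  unfolding tspace_def
  by (intro countably_generated_PiM countably_generated_standard_borel) auto

text \<open>Intersecting with \<open>S\<close> makes the empty family contribute \<open>S\<close>
  instead of the whole type.\<close>

lemma Int_stable_finite_Inter:
  "Int_stable {\<Inter>F \<inter> S | F. finite F \<and> F \<subseteq> G}"
proof (rule Int_stableI)
  fix a b assume "a \<in> {\<Inter>F \<inter> S | F. finite F \<and> F \<subseteq> G}" "b \<in> {\<Inter>F \<inter> S | F. finite F \<and> F \<subseteq> G}"
  then obtain F F' where "a = \<Inter>F \<inter> S" "finite F" "F \<subseteq> G" "b = \<Inter>F' \<inter> S" "finite F'" "F' \<subseteq> G"
    by auto
  then have "a \<inter> b = \<Inter>(F \<union> F') \<inter> S" "finite (F \<union> F')" "F \<union> F' \<subseteq> G" by auto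
  then show "a \<inter> b \<in> {\<Inter>F \<inter> S | F. finite F \<and> F \<subseteq> G}" by blast
qed

text \<open>A countable set has only countably many finite subsets, so closing a countable generator
  under finite intersections keeps it countable and turns it into a \<pi>-system.\<close>

lemma countably_generated_Int_stable:
  assumes "countably_generated M"
  obtains G where "countable G" "Int_stable G" "G \<subseteq> Pow (space M)" "space M \<in> G"
    "sets M = sigma_sets (space M) G"
proof -
  obtain G where G: "countable G" "G \<subseteq> Pow (space M)" "sets M = sigma_sets (space M) G"
    using assms by (auto simp: countably_generated_def)
  let ?H = "{\<Inter>F \<inter> space M | F. finite F \<and> F \<subseteq> G}"
  have "countable {F. finite F \<and> F \<subseteq> G}" using G(1) by (rule countable_Collect_finite_subset)
  moreover have "?H = (\<lambda>F. \<Inter>F \<inter> space M) ` {F. finite F \<and> F \<subseteq> G}" by auto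
  ultimately have countable: "countable ?H" by simp
  have sub: "?H \<subseteq> Pow (space M)" by auto
  have space: "space M \<in> ?H" by (auto intro!: exI[of _ "{}"])
  have "sigma_sets (space M) G = sigma_sets (space M) ?H"
  proof (rule sigma_sets_eqI)
    fix a assume a: "a \<in> G"
    then have "a = \<Inter>{a} \<inter> space M" using G(2) by auto
    then have "a \<in> ?H" using a by blast
    then show "a \<in> sigma_sets (space M) ?H" by (rule sigma_sets.Basic)
  next
    fix b assume "b \<in> ?H"
    then obtain F where F: "b = \<Inter>F \<inter> space M" "finite F" "F \<subseteq> G" by auto
    have "\<Inter>F \<inter> space M \<in> sets M"
      using F(2,3)
    proof (induction F rule: finite_induct)
      case (insert x F)
      then have "x \<in> sets M" using G(3) by (auto intro: sigma_sets.Basic)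
      then show ?case using insert by (auto simp: Int_assoc)
    qed simp
    then show "b \<in> sigma_sets (space M) G" using F G(3) by simp
  qed
  then have "sets M = sigma_sets (space M) ?H" using G(3) by (rule trans[rotated])
  from that[OF countable Int_stable_finite_Inter sub space this] show thesis .
qed

text \<open>For fixed \<open>C\<close> the two functions of \<open>D\<close> are densities of the
  same measure and agree almost everywhere. Countably many exceptional null sets, one for each
  member of a generating \<pi>-system, can be merged, and off their union the measures
  coincide.\<close>

lemma AE_kernel_eq:
  assumes R: "countably_generated R" and Q: "finite_measure Q"
    and k: "k \<in> Q \<rightarrow>\<^sub>M prob_algebra R" and k': "k' \<in> Q \<rightarrow>\<^sub>M prob_algebra R"
    and eq: "\<And>A C. A \<in> sets Q \<Longrightarrow> C \<in> sets R \<Longrightarrow>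
      (\<integral>\<^sup>+D. emeasure (k D) C * indicator A D \<partial>Q) = (\<integral>\<^sup>+D. emeasure (k' D) C * indicator A D \<partial>Q)"
  shows "AE D in Q. k D = k' D"
proof -
  obtain G where G: "countable G" "Int_stable G" "G \<subseteq> Pow (space R)" "space R \<in> G"
    "sets R = sigma_sets (space R) G"
    using countably_generated_Int_stable[OF R] .
  have "AE D in Q. emeasure (k D) C = emeasure (k' D) C" if "C \<in> G" for C
  proof -
    have C: "C \<in> sets R" using that G by (simp add: sigma_sets.Basic)
    show ?thesis
      using measurable_compose[OF measurable_prob_algebraD[OF k] measurable_emeasure_subprob_algebra[OF C]]
        measurable_compose[OF measurable_prob_algebraD[OF k'] measurable_emeasure_subprob_algebra[OF C]]
        eq[OF _ C]
      by (intro finite_measure.density_unique_finite_measure[OF Q]) auto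
  qed
  then have "AE D in Q. \<forall>C\<in>G. emeasure (k D) C = emeasure (k' D) C"
    using G(1) by (simp add: AE_ball_countable)
  moreover have "AE D in Q. D \<in> space Q" by simp
  ultimately show ?thesis
  proof eventually_elim
    case (elim D)
    have s: "sets (k D) = sets R" "prob_space (k D)" "sets (k' D) = sets R"
      using measurable_space[OF k elim(2)] measurable_space[OF k' elim(2)]
      by (auto simp: space_prob_algebra)
    show ?case
    proof (rule measure_eqI_generator_eq_countable[OF G(2,3), of "k D" "k' D" "{space R}"])
      have "finite_measure (k D)" using s(2) by (rule prob_space.finite_measure)
      then show "emeasure (k D) a \<noteq> \<infinity>" for a by (simp add: finite_measure.emeasure_finite)
    qed (use elim s G in auto)
  qed
qed

section \<open>Composition of regular functionals\<close>

text \<open>The derivation is replayed with each \<open>Arg\<close> leaf replaced by a derivation of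
  that argument from \<open>\<Delta>\<close>; the other rules touch the argument list only through
  their premises. The kernel and its reference measure are preserved at every step.\<close>

lemma reg_value_subst:
  assumes "reg_value \<Gamma> F K \<rho>"
    and "\<And>n. n < length \<Gamma> \<Longrightarrow> \<exists>F'. reg_value \<Delta> F' (fst (\<Gamma> ! n)) (snd (\<Gamma> ! n))"
  shows "\<exists>F'. reg_value \<Delta> F' K \<rho>"
  using assms(1)
proof induction
  case (Arg n)
  then show ?case using assms(2) by blast
qed (blast intro: reg_value.intros)+

text \<open>Arguments may sit at other positions in \<open>\<Delta>\<close>, so the functional
  changes by a reindexing of its leaves.\<close>

lemma reg_value_mono:
  assumes "reg_value \<Gamma> F K \<rho>" and "set \<Gamma> \<subseteq> set \<Delta>"
    and "\<forall>(\<mu>, \<sigma>) \<in> set \<Gamma>. prob_kernel \<mu> \<and> prob_on (kdom \<mu>) \<sigma>"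
  shows "\<exists>F'. reg_value \<Delta> F' K \<rho>"
proof (rule reg_value_subst[OF assms(1)])
  fix n assume n: "n < length \<Gamma>"
  then have "\<Gamma> ! n \<in> set \<Delta>" using assms(2) by auto
  then obtain m where "m < length \<Delta>" "\<Delta> ! m = \<Gamma> ! n" by (auto simp: in_set_conv_nth)
  then show "\<exists>F'. reg_value \<Delta> F' (fst (\<Gamma> ! n)) (snd (\<Gamma> ! n))"
    using reg_value.Arg[of m \<Delta>] assms(3) nth_mem[OF n] by (auto simp: case_prod_beta)
qed

text \<open>Each identifiable kernel brings its own list of directly identifiable ones;
  concatenation gives a single list from which all of them can be computed.\<close>

lemma identifiable_common_data:
  assumes "\<forall>(\<mu>, \<sigma>) \<in> set \<Gamma>. identifiable M P Ns W \<mu> \<sigma>"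
  shows "\<exists>\<Delta>. (\<forall>(\<mu>, \<sigma>) \<in> set \<Delta>. directly_identifiable M P Ns W \<mu> \<sigma>) \<and>
    (\<forall>(\<mu>, \<sigma>) \<in> set \<Gamma>. \<exists>F. reg_value \<Delta> F \<mu> \<sigma>)"
  using assms
proof (induction \<Gamma>)
  case (Cons a \<Gamma>)
  obtain \<mu> \<sigma> where a: "a = (\<mu>, \<sigma>)" by fastforce
  obtain \<Delta> where \<Delta>: "\<forall>(\<mu>, \<sigma>) \<in> set \<Delta>. directly_identifiable M P Ns W \<mu> \<sigma>"
    "\<forall>(\<mu>, \<sigma>) \<in> set \<Gamma>. \<exists>F. reg_value \<Delta> F \<mu> \<sigma>"
    using Cons by auto
  obtain \<Delta>' F' where \<Delta>': "\<forall>(\<mu>, \<sigma>) \<in> set \<Delta>'. directly_identifiable M P Ns W \<mu> \<sigma>" "reg_value \<Delta>' F' \<mu> \<sigma>"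
    using Cons.prems a by (auto simp: identifiable_def)
  have "\<exists>F. reg_value (\<Delta> @ \<Delta>') F \<mu>' \<sigma>'" if "(\<mu>', \<sigma>') \<in> set (a # \<Gamma>)" for \<mu>' \<sigma>'
  proof -
    have "\<exists>\<Delta>1 F1. reg_value \<Delta>1 F1 \<mu>' \<sigma>' \<and> (\<Delta>1 = \<Delta> \<or> \<Delta>1 = \<Delta>')"
    proof (cases "(\<mu>', \<sigma>') = a")
      case True
      then show ?thesis using a \<Delta>'(2) by auto
    next
      case False
      then have "\<exists>F. reg_value \<Delta> F \<mu>' \<sigma>'" using that \<Delta>(2) by auto
      then show ?thesis by blast
    qed
    then obtain \<Delta>1 F1 where "reg_value \<Delta>1 F1 \<mu>' \<sigma>'" "\<Delta>1 = \<Delta> \<or> \<Delta>1 = \<Delta>'"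
      by blast
    then show ?thesis
      using \<Delta>(1) \<Delta>'(1) by (intro reg_value_mono[of \<Delta>1 F1]) (auto simp: directly_identifiable_def)
  qed
  then show ?case using \<Delta>(1) \<Delta>'(1) by (intro exI[of _ "\<Delta> @ \<Delta>'"]) auto
qed (auto intro: exI[of _ "[]"])

lemma identifiable_trans:
  assumes "\<forall>(\<mu>, \<sigma>) \<in> set \<Gamma>. identifiable M P Ns W \<mu> \<sigma>" "reg_value \<Gamma> F K \<rho>"
  shows "identifiable M P Ns W K \<rho>"
proof -
  obtain \<Delta> where \<Delta>: "\<forall>(\<mu>, \<sigma>) \<in> set \<Delta>. directly_identifiable M P Ns W \<mu> \<sigma>"
    "\<forall>(\<mu>, \<sigma>) \<in> set \<Gamma>. \<exists>F. reg_value \<Delta> F \<mu> \<sigma>"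
    using identifiable_common_data[OF assms(1)] by auto
  have "\<exists>F'. reg_value \<Delta> F' K \<rho>"
    by (rule reg_value_subst[OF assms(2)]) (use \<Delta>(2) nth_mem in \<open>fastforce simp: case_prod_beta\<close>)
  then show ?thesis using \<Delta>(1) by (auto simp: identifiable_def)
qed

lemma identifiable_Regard:
  assumes "identifiable M P Ns W K (distr \<rho> (tspace (kdom K)) (tpick ws))"
    and "prob_on As \<rho>" "regardable As ws Bs K"
  shows "identifiable M P Ns W (kregard As ws Bs K) \<rho>"
  using assms reg_value.Regard unfolding identifiable_def by blast

section \<open>The structured query in the realized world\<close>

lemma map_nth_filter: "map ((!) ns) (filter (\<lambda>k. Q (ns ! k)) [0..<length ns]) = filter Q ns"
  by (metis (no_types, lifting) comp_apply filter_cong filter_map map_nth)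

locale structured_setting =
  fixes M :: "('i, 'g, 'v) model" and P :: "('i \<Rightarrow> 'v) measure"
    and Ns :: "nat set" and W :: "nat \<Rightarrow> 'i set"
    and PD :: "('i \<Rightarrow> 'v) \<Rightarrow> ('i \<Rightarrow> 'v) measure"
    and G :: "('n, 'v) sgraph" and \<psi> :: "'n \<Rightarrow> 'i" and Y :: "'n set" and os ns :: "'n list"
  assumes model: "causal_model M" and acyclic: "acyclic (iedges M)" and past: "finite_past M"
    and shallow: "shallow_distribution M P"
    and viewport: "viewport M Ns W"
    and realized: "realized_world M P (visible Ns W) PD"
    and query: "structured_query M (visible Ns W) G \<psi> Y"
    and os: "distinct os" "set os = sg_outer G"
    and ns: "causal_order (sg_edges G) (sg_inner G) ns"
begin

abbreviation "N \<equiv> sg_inner G \<union> sg_outer G"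
abbreviation "VV \<equiv> visible Ns W"
abbreviation "val \<equiv> m_val M"
abbreviation "SK \<equiv> structured_kernel G os ns (sg_inner G - Y)"

section \<open>Index tuples and the candidate kernel\<close>

definition "xs = map \<psi> os"
text \<open>\<open>js\<close> holds the positions kept by \<open>structured_kernel\<close> and
  \<open>yn\<close> the nodes found there, so that \<open>ys\<close> inherits the order of the
  target factors of \<open>SK\<close>.\<close>

definition "js = filter (\<lambda>k. ns ! k \<notin> sg_inner G - Y) [0..<length ns]"
definition "yn = filter (\<lambda>n. n \<notin> sg_inner G - Y) ns"
definition "ys = map \<psi> yn"
text \<open>\<open>SK\<close> has the value spaces of the graph, the target of the query those of the model.\<close>

definition "K = kregard (map val xs) [0..<length xs] (map val ys) SK"

text \<open>The reflexive closure also excludes the images of the inner nodes, which are therefore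
  new with respect to every subset of this set.\<close>

definition "non_desc = {i \<in> m_idx M. \<forall>n \<in> sg_inner G. (\<psi> n, i) \<notin> (iedges M)\<^sup>*}"

lemma emb: "embedding M G \<psi>" and Y_inner: "Y \<subseteq> sg_inner G"
  and ancestral: "empty_ancestral_valid M G \<psi>"
  and not_visible: "\<And>n v. n \<in> sg_inner G \<Longrightarrow> v \<in> VV \<Longrightarrow> (\<psi> n, v) \<notin> (iedges M)\<^sup>*"
  using query by (auto simp: structured_query_def)

lemma aligned: "model_aligned G" and inj: "inj_on \<psi> N" and image_idx: "\<psi> ` N \<subseteq> m_idx M"
  and kern: "\<And>n. n \<in> sg_inner G \<Longrightarrow> sg_kern G n = mech_at M (\<psi> n)"
  and pa: "\<And>n. n \<in> sg_inner G \<Longrightarrow> map \<psi> (sg_pa G n) = par_at M (\<psi> n)"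
  and val_outer: "\<And>n. n \<in> sg_outer G \<Longrightarrow> sets (sg_val G n) = sets (val (\<psi> n))"
  and par_N: "\<And>n. n \<in> sg_inner G \<Longrightarrow> set (par_at M (\<psi> n)) \<subseteq> \<psi> ` N"
  and edges: "\<And>n n'. n' \<in> sg_inner G \<Longrightarrow> n \<in> N \<Longrightarrow>
    (n, n') \<in> sg_edges G \<longleftrightarrow> \<psi> n \<in> set (par_at M (\<psi> n'))"
  using emb by (auto simp: embedding_def)

lemma fin_inner: "finite (sg_inner G)" and fin_outer: "finite (sg_outer G)"
  and disj: "sg_inner G \<inter> sg_outer G = {}"
  and edges_sub: "sg_edges G \<subseteq> N \<times> sg_inner G"
  and acyclic_G: "acyclic (sg_edges G)"
  using aligned by (auto simp: model_aligned_def structural_graph_def)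

lemma idx: "n \<in> N \<Longrightarrow> \<psi> n \<in> m_idx M"
  using image_idx by auto

lemma ns_set: "set ns = sg_inner G" "distinct ns"
  using ns by (auto simp: causal_order_def)

lemma yn_set: "set yn = Y" "distinct yn"
  using ns_set Y_inner by (auto simp: yn_def)

lemma xs: "distinct xs" "set xs = \<psi> ` sg_outer G" "set xs \<subseteq> m_idx M"
  using os inj idx by (auto simp: xs_def distinct_map intro: inj_on_subset)

lemma ys: "distinct ys" "set ys = \<psi> ` Y" "set ys \<subseteq> m_idx M" "set ys \<subseteq> \<psi> ` sg_inner G"
proof -
  have "inj_on \<psi> Y" using inj Y_inner by (auto intro: inj_on_subset)
  then show "distinct ys" using yn_set by (simp add: ys_def distinct_map)
qed (use yn_set Y_inner idx in \<open>auto simp: ys_def\<close>)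

lemma node_ok_G: "n \<in> sg_inner G \<Longrightarrow> node_ok (sg_kern G) (sg_pa G) (sg_val G) n"
  using aligned by (auto simp: model_aligned_def meas_subspace_sets_eq prob_kernel_def)

text \<open>An inner node has the target space of its mechanism as value space, possibly smaller
  than the one in the model; for an outer node the two have the same measurable sets.\<close>

lemma val_sub:
  assumes "n \<in> N"
  shows "meas_subspace (sg_val G n) (val (\<psi> n))" "standard_borel (val (\<psi> n))"
proof -
  show "standard_borel (val (\<psi> n))" using model idx[OF assms] by (simp add: causal_model_def)
  show "meas_subspace (sg_val G n) (val (\<psi> n))"
  proof (cases "n \<in> sg_inner G")
    case True
    then have "kcod (mech_at M (\<psi> n)) = [sg_val G n]"
      using aligned kern by (auto simp: model_aligned_def)
    then show ?thesis using node_ok_model(1)[OF model idx[OF assms]] by simp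
  next
    case False
    then show ?thesis using assms val_outer by (auto intro: meas_subspace_sets_eq)
  qed
qed

lemma wired_ok_G: "wired_ok (sg_kern G) (sg_pa G) (sg_val G) os ns"
  and outer_borel: "\<forall>m\<in>set os. standard_borel (sg_val G m)"
proof -
  have p: "set (sg_pa G n) = {m. (m, n) \<in> sg_edges G}" if "n \<in> sg_inner G" for n
    using that aligned by (auto simp: model_aligned_def)
  show "wired_ok (sg_kern G) (sg_pa G) (sg_val G) os ns"
    by (rule wired_ok_causal_order[OF ns acyclic_G os(1)])
      (use os p node_ok_G disj edges_sub in \<open>auto simp del: node_ok_def\<close>)
  show "\<forall>m\<in>set os. standard_borel (sg_val G m)"
    using os aligned by (auto simp: model_aligned_def)
qed

lemma SK: "prob_kernel SK" "kdom SK = map (sg_val G) os" "kcod SK = map (sg_val G) yn"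
  and js: "set js \<subseteq> {..<length ns}" "map ((!) ns) js = yn"
proof -
  show js: "set js \<subseteq> {..<length ns}" by (auto simp: js_def)
  show map_js: "map ((!) ns) js = yn" unfolding js_def yn_def by (rule map_nth_filter)
  note W = wired_product_kernel[OF wired_ok_G outer_borel]
  have "SK = kselect js (wired_product (sg_kern G) (sg_pa G) (sg_val G) os ns)"
    by (simp add: structured_kernel_def js_def)
  moreover have "map (\<lambda>j. map (sg_val G) ns ! j) js = map (sg_val G) yn"
    using js unfolding map_js[symmetric] by (auto simp: subset_iff)
  ultimately show "prob_kernel SK" "kdom SK = map (sg_val G) os" "kcod SK = map (sg_val G) yn"
    using W js prob_kernel_kselect[of "wired_product (sg_kern G) (sg_pa G) (sg_val G) os ns" js]
    by (auto simp: kselect_def)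
qed

lemma K_regardable: "regardable (map val xs) [0..<length xs] (map val ys) SK"
proof -
  have "list_all2 meas_subspace (map val xs) (map (sg_val G) os)"
    using os val_outer nth_mem[of _ os]
    by (simp add: xs_def list_all2_conv_all_nth meas_subspace_sets_eq del: nth_mem)
  moreover have "map (\<lambda>w. map val xs ! w) [0..<length xs] = map val xs"
    by (metis length_map map_nth)
  moreover have "list_all2 meas_subspace (map (sg_val G) yn) (map val ys)"
    using yn_set Y_inner val_sub(1) nth_mem[of _ yn] by (force simp: ys_def list_all2_conv_all_nth)
  ultimately show ?thesis
    using SK val_sub(2) os yn_set Y_inner
    by (auto simp: regardable_def xs_def ys_def)
qed

lemma K: "prob_kernel K" "kdom K = map val xs" "kcod K = map val ys"
  using prob_kernel_kregard[OF SK(1) K_regardable] by (auto simp: K_def kregard_def)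

text \<open>Expresses the candidate kernel by the mechanisms of the model. The environment
  \<open>v\<close> is constrained at \<open>xs\<close> only, so it may already carry the values of
  further indices; this is how independence from the remaining past is expressed.\<close>

lemma nn_integral_K:
  assumes v: "\<And>x. x \<in> set xs \<Longrightarrow> v x \<in> space (val x)"
    and h: "h \<in> borel_measurable (tspace (map val ys))"
  shows "(\<integral>\<^sup>+t. h t \<partial>kmap K (tpick xs v)) =
    wired_int (mech_at M) (par_at M) (map \<psi> ns) v (\<lambda>w. h (tpick ys w))"
proof -
  let ?W = "wired_product (sg_kern G) (sg_pa G) (sg_val G) os ns"
  note W = wired_product_kernel[OF wired_ok_G outer_borel]
  have s: "tpick xs v \<in> space (tspace (map val xs))"
    using v by (intro tpick_in_tspace)
  have v': "\<forall>m\<in>set os. (v \<circ> \<psi>) m \<in> space (sg_val G m)"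
    using v os sets_eq_imp_space_eq[OF val_outer] by (simp add: xs_def)
  have s': "tpick os (v \<circ> \<psi>) \<in> space (tspace (map (sg_val G) os))"
    using v' by (intro tpick_in_tspace) auto
  have eq: "tpick [0..<length xs] (tpick xs v) = tpick os (v \<circ> \<psi>)"
    using tpick_upt_tspace[OF s] by (auto simp: tpick_def xs_def)
  have h': "h \<in> borel_measurable (tspace (map (sg_val G) yn))"
  proof -
    have "list_all2 meas_subspace (map (sg_val G) yn) (map val ys)"
      using K_regardable SK by (simp add: regardable_def)
    from measurable_compose[OF measurable_tspace_meas_subspace[OF this measurable_ident_sets[OF refl]] h]
    show ?thesis by simp
  qed
  have mjs: "map (\<lambda>j. map (sg_val G) ns ! j) js = map (sg_val G) yn"
    using js(1) unfolding js(2)[symmetric] by (auto simp: subset_iff)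
  have "(\<integral>\<^sup>+t. h t \<partial>kmap K (tpick xs v)) = (\<integral>\<^sup>+t. h t \<partial>kmap SK (tpick os (v \<circ> \<psi>)))"
    unfolding K_def nn_integral_kregard[OF SK(1) K_regardable s h] eq ..
  also have "\<dots> = (\<integral>\<^sup>+u. h (tpick js u) \<partial>kmap ?W (tpick os (v \<circ> \<psi>)))"
    unfolding structured_kernel_def js_def[symmetric]
    by (rule nn_integral_kselect) (use W js s' h' mjs in auto)
  also have "\<dots> = wired_int (sg_kern G) (sg_pa G) ns (v \<circ> \<psi>) (\<lambda>w. h (tpick js (tpick ns w)))"
  proof (rule nn_integral_wired_product[OF wired_ok_G outer_borel v'])
    have "tpick js \<in> tspace (map (sg_val G) ns) \<rightarrow>\<^sub>M tspace (map (sg_val G) yn)"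
      using measurable_tpick_tspace[of js "map (sg_val G) ns"] js(1) mjs by simp
    from measurable_compose[OF this h']
    show "(\<lambda>u. h (tpick js u)) \<in> borel_measurable (tspace (map (sg_val G) ns))" .
  qed
  also have "\<dots> = wired_int (mech_at M) (par_at M) (map \<psi> ns) v (\<lambda>w. h (tpick ys w))"
  proof (rule wired_int_relabel[OF inj])
    show "set ns \<subseteq> N" using ns_set by auto
    fix n assume n: "n \<in> set ns"
    have "set (sg_pa G n) \<subseteq> N"
      using n ns_set aligned edges_sub by (auto simp: model_aligned_def)
    then show "sg_kern G n = mech_at M (\<psi> n) \<and> map \<psi> (sg_pa G n) = par_at M (\<psi> n) \<and> set (sg_pa G n) \<subseteq> N"
      using n ns_set kern pa by simp
  next
    fix w :: "'n \<Rightarrow> 'v" and w' assume w: "\<And>m. m \<in> N \<Longrightarrow> w m = w' (\<psi> m)"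
    have "tpick js (tpick ns w) = tpick yn w"
      using tpick_tpick[OF js(1), of w] js(2) by simp
    also have "\<dots> = tpick ys w'"
      using w yn_set Y_inner nth_mem[of _ yn] by (fastforce simp: tpick_def ys_def)
    finally show "h (tpick js (tpick ns w)) = h (tpick ys w')" by simp
  qed simp
  finally show ?thesis .
qed

section \<open>Ancestor-closed sets of non-descendants\<close>

lemma outer_non_desc: "\<psi> ` sg_outer G \<subseteq> non_desc"
proof
  fix x assume "x \<in> \<psi> ` sg_outer G"
  then obtain n where n: "n \<in> sg_outer G" "x = \<psi> n" by auto
  let ?E = "iedges M - map_prod \<psi> \<psi> ` sg_edges G"
  \<comment> \<open>After its last visit to an inner node a path runs through edges that are not in the graph,
    since all edges of the graph point to inner nodes.\<close>
  have *: "(a, x) \<in> ?E\<^sup>* \<or> (\<exists>m\<in>sg_inner G. (\<psi> m, x) \<in> ?E\<^sup>*)" if "(a, x) \<in> (iedges M)\<^sup>*" for a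
    using that
  proof (induction rule: converse_rtrancl_induct)
    case (step a b)
    show ?case
    proof (cases "(a, b) \<in> ?E")
      case True
      then show ?thesis using step.IH by (meson converse_rtrancl_into_rtrancl)
    next
      case False
      then obtain m where "m \<in> sg_inner G" "b = \<psi> m" using step.hyps edges_sub by auto
      then show ?thesis using step.IH by auto
    qed
  qed simp
  have "(\<psi> m, x) \<notin> ?E\<^sup>*" if "m \<in> sg_inner G" for m
    using ancestral n that by (auto simp: empty_ancestral_valid_def)
  then show "x \<in> non_desc" using * n idx by (auto simp: non_desc_def)
qed

lemma visible_idx: "VV \<subseteq> m_idx M"
  using viewport by (auto simp: viewport_def visible_def)

lemma visible_non_desc: "VV \<subseteq> non_desc"
  using not_visible visible_idx by (auto simp: non_desc_def)

lemma non_desc_closed: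
  assumes "i \<in> non_desc" "(a, i) \<in> (iedges M)\<^sup>*"
  shows "a \<in> non_desc"
proof -
  have "a \<in> m_idx M"
    using assms iedges_subset[OF model] by (auto simp: non_desc_def elim: converse_rtranclE)
  then show ?thesis using assms rtrancl_trans by (fastforce simp: non_desc_def)
qed

definition "anc J = {a. \<exists>j\<in>J. (a, j) \<in> (iedges M)\<^sup>*}"

text \<open>The shallow distribution is specified on finite ancestor-closed sets. Finite past makes
  it applicable to any finite part of \<open>non_desc\<close>, by closing up without leaving that
  set.\<close>

lemma anc:
  assumes "finite J" "J \<subseteq> non_desc"
  shows "finite (anc J)" "anc J \<subseteq> non_desc" "J \<subseteq> anc J" "\<And>i. i \<in> anc J \<Longrightarrow> set (par_at M i) \<subseteq> anc J"
proof -
  have "anc J \<subseteq> (\<Union>j\<in>J. insert j {a. (a, j) \<in> (iedges M)\<^sup>+})"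
    by (auto simp: anc_def rtrancl_eq_or_trancl)
  moreover have "finite (\<Union>j\<in>J. insert j {a. (a, j) \<in> (iedges M)\<^sup>+})"
    using assms past by (auto simp: finite_past_def non_desc_def)
  ultimately show "finite (anc J)" by (rule finite_subset)
  show sub: "anc J \<subseteq> non_desc" using assms(2) non_desc_closed by (auto simp: anc_def)
  show "J \<subseteq> anc J" by (auto simp: anc_def)
  fix i assume i: "i \<in> anc J"
  then have "i \<in> m_idx M" using sub by (auto simp: non_desc_def)
  then have "(a, i) \<in> iedges M" if "a \<in> set (par_at M i)" for a
    using that by (simp add: iedges_def)
  then show "set (par_at M i) \<subseteq> anc J"
    using i by (auto simp: anc_def) (meson converse_rtrancl_into_rtrancl)
qed

text \<open>No edge leads backwards: within \<open>is\<close> and within the inner nodes by the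
  given orders, as graph edges mirror those of the model, and from an inner node into
  \<open>A\<close> because \<open>A\<close> contains no descendants of inner nodes.\<close>

lemma causal_order_extend:
  assumes A: "A \<subseteq> non_desc" "causal_order (iedges M) A is"
  shows "causal_order (iedges M) (A \<union> \<psi> ` sg_inner G) (is @ map \<psi> ns)"
proof -
  have iset: "set is = A" "distinct is" using A by (auto simp: causal_order_def)
  have new: "\<psi> n \<notin> non_desc" if "n \<in> sg_inner G" for n using that by (auto simp: non_desc_def)
  have "distinct (map \<psi> ns)"
    using ns_set inj by (auto simp: distinct_map intro: inj_on_subset)
  then have "distinct (is @ map \<psi> ns)" using iset new A(1) ns_set by auto
  moreover have "set (is @ map \<psi> ns) = A \<union> \<psi> ` sg_inner G" using iset ns_set by auto
  moreover have "((is @ map \<psi> ns) ! b, (is @ map \<psi> ns) ! a) \<notin> iedges M"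
    if ab: "a < b" "b < length (is @ map \<psi> ns)" for a b
  proof (cases "b < length is")
    case True
    then show ?thesis using ab A by (auto simp: causal_order_def nth_append)
  next
    case b: False
    then have b_less: "b - length is < length ns" using ab by auto
    have bn: "(is @ map \<psi> ns) ! b = \<psi> (ns ! (b - length is))" "ns ! (b - length is) \<in> sg_inner G"
        using nth_mem[of "b - length is" ns] b_less b by (simp_all add: nth_append ns_set)
    show ?thesis
    proof (cases "a < length is")
      case True
      then have "is ! a \<in> non_desc" using iset A(1) nth_mem by blast
      then show ?thesis using bn True by (auto simp: nth_append non_desc_def)
    next
      case a: False
      then have a_less: "a - length is < length ns" using ab by auto
      have an: "(is @ map \<psi> ns) ! a = \<psi> (ns ! (a - length is))" "ns ! (a - length is) \<in> sg_inner G"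
        using nth_mem[of "a - length is" ns] a_less a by (simp_all add: nth_append ns_set)
      have "(ns ! (b - length is), ns ! (a - length is)) \<notin> sg_edges G"
        using ns ab a b b_less by (auto simp: causal_order_def)
      then show ?thesis unfolding an bn using edges[OF an(2)] bn(2) by (auto simp: iedges_def)
    qed
  qed
  ultimately show ?thesis by (auto simp: causal_order_def)
qed

section \<open>The product formula under the shallow distribution\<close>

definition "\<kappa> C s = (\<integral>\<^sup>+t. indicator C (tcat (length xs) (length ys) s t) \<partial>kmap K s :: ennreal)"

text \<open>\<open>\<kappa> C s\<close> is the conditional mass of the section of \<open>C\<close>
  at \<open>s\<close>; integrating it over the law of the \<open>xs\<close> tuple gives the mass of
  \<open>C\<close> under the product with \<open>K\<close>.\<close>

lemma \<kappa>_measurable: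
  assumes "C \<in> sets (tspace (map val (xs @ ys)))"
  shows "\<kappa> C \<in> borel_measurable (tspace (map val xs))"
  using nn_integral_sprod(2)[OF refl prob_kernelD(1)[OF K(1), unfolded K(2,3)], of "indicator C"] assms
  by (simp add: \<kappa>_def[abs_def])

text \<open>The conditional independence at the core: given the outer nodes, finitely many visible
  values carry no further information on the inner ones. The inner nodes are last in a causal order
  and are integrated out first, while \<open>I\<close> and the \<open>xs\<close> tuple stay
  fixed.\<close>

lemma box_integral:
  assumes J: "finite J" "J \<subseteq> VV" and A: "\<And>j. j \<in> J \<Longrightarrow> A j \<in> sets (val j)"
    and C: "C \<in> sets (tspace (map val (xs @ ys)))"
  defines "I \<equiv> indicator {v. \<forall>j\<in>J. v j \<in> A j} :: _ \<Rightarrow> ennreal"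
  shows "(\<integral>\<^sup>+v. I v * indicator C (tpick (xs @ ys) v) \<partial>P) = (\<integral>\<^sup>+v. I v * \<kappa> C (tpick xs v) \<partial>P)"
proof -
  let ?D = "anc (J \<union> set xs)"
  have J_non_desc: "finite (J \<union> set xs)" "J \<union> set xs \<subseteq> non_desc"
    using J visible_non_desc outer_non_desc xs fin_outer by auto
  note D = anc[OF J_non_desc]
  have D_idx: "?D \<subseteq> m_idx M" using D(2) by (auto simp: non_desc_def)
  obtain "is" where "is": "causal_order (iedges M) ?D is"
    using causal_order_exists[OF D(1) acyclic] by auto
  have is_set: "set is = ?D" using "is" by (simp add: causal_order_def)
  let ?D' = "?D \<union> \<psi> ` sg_inner G"
  let ?w = "wired_int (mech_at M) (par_at M)"
  let ?v0 = "\<lambda>_. undefined"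
  \<comment> \<open>The index set \<open>E\<close> is left open because \<open>I\<close> is
    integrated both over the closed set \<open>?D\<close> and over its extension \<open>?D'\<close>
    by the inner nodes.\<close>
  have I_meas: "I \<in> borel_measurable (PiM E val)" if "J \<subseteq> E" for E
    unfolding I_def
  proof (subst borel_measurable_indicator_iff)
    have "{v \<in> space (PiM E val). \<forall>j\<in>J. v j \<in> A j} \<in> sets (PiM E val)"
      using J(1) that A
      by (intro sets.sets_Collect_finite_All)
        (auto intro!: measurable_sets_Collect[OF measurable_component_singleton] sets.sets_into_space)
    then show "{v. \<forall>j\<in>J. v j \<in> A j} \<inter> space (PiM E val) \<in> sets (PiM E val)"
      by (simp add: Int_def conj_commute)
  qed
  have I_eq: "I v = I v'" if "\<And>j. j \<in> J \<Longrightarrow> v j = v' j" for v v'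
    using that by (auto simp: I_def indicator_def)
  have ok: "wired_ok (mech_at M) (par_at M) val [] is"
    using node_ok_model(1)[OF model] D(4) D_idx
    by (intro wired_ok_causal_order[OF "is" acyclic]) (auto simp: iedges_def simp del: node_ok_def)
  have par_D': "set (par_at M i) \<subseteq> ?D'" if "i \<in> ?D'" for i
  proof -
    have "\<psi> ` N \<subseteq> ?D'" using D(3) xs by auto
    then show ?thesis using that D(4)[of i] par_N by (cases "i \<in> ?D") blast+
  qed
  have new: "\<psi> n \<notin> non_desc" if "n \<in> sg_inner G" for n using that by (auto simp: non_desc_def)
  have ok': "wired_ok (mech_at M) (par_at M) val is (map \<psi> ns)"
  proof (rule wired_ok_causal_order[where E = "iedges M" and A = "\<psi> ` sg_inner G"])
    have ord: "causal_order (iedges M) ?D' (is @ map \<psi> ns)"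
      by (rule causal_order_extend[OF D(2) "is"])
    show "causal_order (iedges M) (\<psi> ` sg_inner G) (map \<psi> ns)"
      unfolding causal_order_def
    proof (intro conjI allI impI)
      fix a b assume "a < b \<and> b < length (map \<psi> ns)"
      then show "(map \<psi> ns ! b, map \<psi> ns ! a) \<notin> iedges M"
        using ord[unfolded causal_order_def, THEN conjunct2, THEN conjunct2, rule_format,
            of "length is + a" "length is + b"] by (simp add: nth_append)
    qed (use ord ns_set in \<open>auto simp: causal_order_def\<close>)
    show "distinct is" using "is" by (simp add: causal_order_def)
    show "set is \<inter> \<psi> ` sg_inner G = {}" using new D(2) is_set by auto
    show "set (par_at M n) \<subseteq> set is \<union> \<psi> ` sg_inner G" if "n \<in> \<psi> ` sg_inner G" for n
      using par_D'[of n] that is_set by simp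
    show "node_ok (mech_at M) (par_at M) val n" if "n \<in> \<psi> ` sg_inner G" for n
      using node_ok_model(1)[OF model] that idx by blast
    show "(m, n) \<in> iedges M" if "n \<in> \<psi> ` sg_inner G" "m \<in> set (par_at M n)" for m n
      using that idx by (auto simp: iedges_def)
  qed (rule acyclic)
  have xs_D: "set xs \<subseteq> ?D" and J_D: "J \<subseteq> ?D" using D(3) by auto
  have "(\<integral>\<^sup>+v. I v * indicator C (tpick (xs @ ys) v) \<partial>P) =
      ?w (is @ map \<psi> ns) ?v0 (\<lambda>v. I v * indicator C (tpick (xs @ ys) v))"
  proof (rule nn_integral_shallow[OF model acyclic shallow _ _ par_D'])
    show "finite ?D'" using D(1) fin_inner by simp
    show "?D' \<subseteq> m_idx M" using D_idx idx by auto
    show "causal_order (iedges M) ?D' (is @ map \<psi> ns)"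
      by (rule causal_order_extend[OF D(2) "is"])
    have "set (xs @ ys) \<subseteq> ?D'" using xs_D ys by auto
    then have t: "tpick (xs @ ys) \<in> PiM ?D' val \<rightarrow>\<^sub>M tspace (map val (xs @ ys))"
      by (rule measurable_tpick_PiM)
    show "(\<lambda>v. I v * indicator C (tpick (xs @ ys) v)) \<in> borel_measurable (PiM ?D' val)"
      using measurable_compose[OF t borel_measurable_indicator[OF C]] J_D
      by (intro borel_measurable_times_ennreal I_meas) auto
    show "I (restrict v ?D') * indicator C (tpick (xs @ ys) (restrict v ?D')) =
        I v * indicator C (tpick (xs @ ys) v)" for v
    proof -
      have "tpick (xs @ ys) (restrict v ?D') = tpick (xs @ ys) v"
        using \<open>set (xs @ ys) \<subseteq> ?D'\<close> by (intro tpick_cong) auto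
      moreover have "I (restrict v ?D') = I v" using J_D by (intro I_eq) auto
      ultimately show ?thesis by simp
    qed
  qed
  also have "\<dots> = ?w is ?v0 (\<lambda>w. ?w (map \<psi> ns) w (\<lambda>v. I v * indicator C (tpick (xs @ ys) v)))"
    by (rule wired_int_append)
  also have "\<dots> = ?w is ?v0 (\<lambda>w. I w * \<kappa> C (tpick xs w))"
  proof (rule wired_int_cong[OF ok])
    fix w assume w: "\<forall>m\<in>set [] \<union> set is. w m \<in> space (val m)"
    have t: "tpick xs w \<in> space (tspace (map val xs))"
      using w xs_D is_set by (intro tpick_in_tspace) auto
    let ?h = "\<lambda>t. indicator C (tcat (length xs) (length ys) (tpick xs w) t) :: ennreal"
    have h: "?h \<in> borel_measurable (tspace (map val ys))"
      using measurable_compose[OF measurable_tcat_Pair[OF t, of "map val ys"] borel_measurable_indicator, of C] C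
      by simp
    have "?w (map \<psi> ns) w (\<lambda>v. I v * indicator C (tpick (xs @ ys) v)) =
        ?w (map \<psi> ns) w (\<lambda>v. I w * ?h (tpick ys v))"
    proof (rule wired_int_cong[OF ok'])
      show "\<forall>m\<in>set is. w m \<in> space (val m)" using w by simp
      fix v assume *: "\<forall>m. m \<notin> set (map \<psi> ns) \<longrightarrow> v m = w m"
      have v: "v m = w m" if "m \<in> ?D" for m
      proof -
        have "m \<notin> set (map \<psi> ns)" using that new D(2) ns_set(1) by auto
        then show ?thesis using * by blast
      qed
      have "I v = I w" using v J_D by (intro I_eq) auto
      moreover have "tpick xs v = tpick xs w" using v xs_D by (intro tpick_cong) auto
      ultimately show "I v * indicator C (tpick (xs @ ys) v) = I w * ?h (tpick ys v)"
        using tcat_tpick[of xs ys v] by simp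
    qed
    \<comment> \<open>\<open>I w\<close> is 0 or 1, and splitting by its value moves it out of the
      iterated integral without a measurability argument.\<close>
    also have "\<dots> = I w * ?w (map \<psi> ns) w (\<lambda>v. ?h (tpick ys v))"
      by (cases "\<forall>j\<in>J. w j \<in> A j") (simp_all add: I_def wired_int_zero)
    also have "\<dots> = I w * \<kappa> C (tpick xs w)"
      unfolding \<kappa>_def using w xs_D is_set by (subst nn_integral_K[OF _ h]) auto
    finally show "?w (map \<psi> ns) w (\<lambda>v. I v * indicator C (tpick (xs @ ys) v)) = I w * \<kappa> C (tpick xs w)" .
  qed simp
  \<comment> \<open>The integrand now reads coordinates in \<open>?D\<close> only, so the formula
    for the shallow distribution is applied backwards on this smaller set.\<close>
  also have "\<dots> = (\<integral>\<^sup>+v. I v * \<kappa> C (tpick xs v) \<partial>P)"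
  proof (rule nn_integral_shallow[OF model acyclic shallow D(1) D_idx D(4) "is", symmetric])
    show "(\<lambda>v. I v * \<kappa> C (tpick xs v)) \<in> borel_measurable (PiM ?D val)"
      using measurable_compose[OF measurable_tpick_PiM[OF xs_D] \<kappa>_measurable[OF C]] J_D
      by (intro borel_measurable_times_ennreal I_meas) auto
    show "I (restrict v ?D) * \<kappa> C (tpick xs (restrict v ?D)) = I v * \<kappa> C (tpick xs v)" for v
    proof -
      have "tpick xs (restrict v ?D) = tpick xs v" using xs_D by (intro tpick_cong) auto
      moreover have "I (restrict v ?D) = I v" using J_D by (intro I_eq) auto
      ultimately show ?thesis by simp
    qed
  qed
  finally show ?thesis .
qed


lemma sets_P: "sets P = sets (PiM (m_idx M) val)" and prob_P: "prob_space P"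
  using shallow by (auto simp: shallow_distribution_def world_space_def)

lemma tpick_world:
  assumes "set is \<subseteq> m_idx M" "sets Q = sets (world_space M)"
  shows "tpick is \<in> Q \<rightarrow>\<^sub>M tspace (map val is)"
  using measurable_tpick_PiM[OF assms(1), of val] assms(2) measurable_cong_sets
  unfolding world_space_def by blast

lemma xs_ys_idx: "set (xs @ ys) \<subseteq> m_idx M"
  using xs ys by auto

lemma restrict_measurable:
  "(\<lambda>v. restrict v VV) \<in> P \<rightarrow>\<^sub>M PiM VV val"
  using measurable_restrict_subset[OF visible_idx, of val] sets_P measurable_cong_sets by blast

lemma emeasure_distr_density:
  assumes "g \<in> P \<rightarrow>\<^sub>M R" "f \<in> borel_measurable P" "A \<in> sets R"
  shows "emeasure (distr (density P f) R g) A = (\<integral>\<^sup>+v. indicator A (g v) * f v \<partial>P)"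
proof -
  have "emeasure (distr (density P f) R g) A = (\<integral>\<^sup>+v. f v * indicator (g -` A \<inter> space P) v \<partial>P)"
    using assms measurable_sets[OF assms(1,3)]
    by (subst emeasure_distr) (simp_all add: emeasure_density)
  also have "\<dots> = (\<integral>\<^sup>+v. indicator A (g v) * f v \<partial>P)"
    by (rule nn_integral_cong) (auto simp: indicator_def)
  finally show ?thesis .
qed

text \<open>As functions of \<open>A\<close> both sides are measures on the visible coordinates,
  namely images of measures with densities under \<open>P\<close>. They agree on finite-dimensional
  cylinders and one of them is finite, hence they are equal even when \<open>VV\<close> is
  infinite.\<close>

lemma visible_integral:
  assumes C: "C \<in> sets (tspace (map val (xs @ ys)))" and A: "A \<in> sets (PiM VV val)"
  shows "(\<integral>\<^sup>+v. indicator A (restrict v VV) * indicator C (tpick (xs @ ys) v) \<partial>P) =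
    (\<integral>\<^sup>+v. indicator A (restrict v VV) * \<kappa> C (tpick xs v) \<partial>P)"
proof -
  let ?R = "PiM VV val" and ?r = "\<lambda>v. restrict v VV"
  let ?f = "\<lambda>v. indicator C (tpick (xs @ ys) v) :: ennreal" and ?g = "\<lambda>v. \<kappa> C (tpick xs v)"
  have sP: "sets P = sets (world_space M)" using sets_P by (simp add: world_space_def)
  have f: "?f \<in> borel_measurable P"
    by (rule measurable_compose[OF tpick_world[OF xs_ys_idx sP] borel_measurable_indicator[OF C]])
  have g: "?g \<in> borel_measurable P"
    by (rule measurable_compose[OF tpick_world[OF xs(3) sP] \<kappa>_measurable[OF C]])
  note d = emeasure_distr_density[OF restrict_measurable]
  have "distr (density P ?f) ?R ?r = distr (density P ?g) ?R ?r"
  proof (rule measure_eqI_PiM_infinite)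
    fix A' J assume J: "finite J" "J \<subseteq> VV" and A': "\<And>i. i \<in> J \<Longrightarrow> A' i \<in> sets (val i)"
    let ?E = "prod_emb VV val J (Pi\<^sub>E J A')"
    have E: "?E \<in> sets ?R" using J A' by (intro sets_PiM_I) auto
    have "indicator ?E (?r v) = (indicator {v. \<forall>j\<in>J. v j \<in> A' j} v :: ennreal)" if "v \<in> space P" for v
    proof -
      have "?r v \<in> space ?R" using measurable_space[OF restrict_measurable that] .
      then have "?r v \<in> ?E \<longleftrightarrow> (\<forall>j\<in>J. v j \<in> A' j)"
        using J(2) by (auto simp: prod_emb_def space_PiM PiE_iff subset_iff)
      then show ?thesis by (simp add: indicator_def)
    qed
    then have *: "(\<integral>\<^sup>+v. indicator ?E (?r v) * h v \<partial>P) =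
        (\<integral>\<^sup>+v. indicator {v. \<forall>j\<in>J. v j \<in> A' j} v * h v \<partial>P)" for h
      by (intro nn_integral_cong) simp
    show "emeasure (distr (density P ?f) ?R ?r) ?E = emeasure (distr (density P ?g) ?R ?r) ?E"
      unfolding d[OF f E] d[OF g E] * by (rule box_integral[OF J A' C])
  next
    have "emeasure (distr (density P ?f) ?R ?r) (space (distr (density P ?f) ?R ?r)) \<le>
        (\<integral>\<^sup>+v. 1 \<partial>P)"
      unfolding space_distr d[OF f sets.top]
      by (rule nn_integral_mono) (auto simp: indicator_def)
    also have "\<dots> < \<infinity>" using prob_space.emeasure_space_1[OF prob_P] by simp
    finally show "finite_measure (distr (density P ?f) ?R ?r)" by (intro finite_measureI) simp
  qed simp_all
  then show ?thesis using d[OF f A] d[OF g A] by simp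
qed

section \<open>Passage to the realized world\<close>

abbreviation "Q \<equiv> distr P (PiM VV val) (\<lambda>v. restrict v VV)"

lemma PD_measurable: "PD \<in> Q \<rightarrow>\<^sub>M prob_algebra (world_space M)"
  using realized by (simp add: realized_world_def)

text \<open>The defining property of \<open>PD\<close> says that \<open>P\<close>, restricted to
  visible data in \<open>A\<close>, is the mixture of the measures \<open>PD D\<close> over
  \<open>D\<close> in \<open>A\<close>. Written as a \<open>bind\<close>, this extends from sets to
  integrands.\<close>

lemma realized_integral:
  assumes A: "A \<in> sets (PiM VV val)" and f: "f \<in> borel_measurable (world_space M)"
  shows "(\<integral>\<^sup>+v. indicator A (restrict v VV) * f v \<partial>P) =
    (\<integral>\<^sup>+D. (\<integral>\<^sup>+v. f v \<partial>PD D) * indicator A D \<partial>Q)"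
proof -
  let ?r = "\<lambda>v. restrict v VV"
  have sP: "sets P = sets (world_space M)" using sets_P by (simp add: world_space_def)
  have iA: "(\<lambda>v. indicator A (?r v) :: ennreal) \<in> borel_measurable P"
    by (rule measurable_compose[OF restrict_measurable borel_measurable_indicator[OF A]])
  have AQ: "A \<in> sets Q" using A by simp
  \<comment> \<open>Over an empty space \<open>bind\<close> would degenerate, so a point of
    \<open>Q\<close> is secured first.\<close>
  have "space P \<noteq> {}" using prob_space.not_empty[OF prob_P] .
  then have ne: "space (density Q (indicator A)) \<noteq> {}"
    using measurable_space[OF restrict_measurable] unfolding space_density space_distr by blast
  have PD: "PD \<in> density Q (indicator A) \<rightarrow>\<^sub>M subprob_algebra (world_space M)"
    using measurable_prob_algebraD[OF PD_measurable] measurable_cong_sets[OF sets_density refl] by blast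
  have "density P (\<lambda>v. indicator A (?r v)) = bind (density Q (indicator A)) PD"
  proof (rule measure_eqI)
    show s: "sets (density P (\<lambda>v. indicator A (?r v))) = sets (bind (density Q (indicator A)) PD)"
      using sP sets_bind[OF subprob_measurableD(2)[OF PD] ne] by simp
    fix C assume "C \<in> sets (density P (\<lambda>v. indicator A (?r v)))"
    then have C: "C \<in> sets P" "C \<in> sets (world_space M)" using sP by auto
    have m: "(\<lambda>D. emeasure (PD D) C) \<in> borel_measurable Q"
      by (rule measurable_compose[OF measurable_prob_algebraD[OF PD_measurable]
            measurable_emeasure_subprob_algebra[OF C(2)]])
    have "emeasure (density P (\<lambda>v. indicator A (?r v))) C =
        (\<integral>\<^sup>+v. indicator A (?r v) * indicator C v \<partial>P)"
      using iA C by (simp add: emeasure_density)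
    also have "\<dots> = (\<integral>\<^sup>+v. indicator {v \<in> space P. ?r v \<in> A \<and> v \<in> C} v \<partial>P)"
      by (rule nn_integral_cong) (auto simp: indicator_def)
    also have "\<dots> = emeasure P {v \<in> space P. ?r v \<in> A \<and> v \<in> C}"
    proof (rule nn_integral_indicator)
      have "{v \<in> space P. ?r v \<in> A \<and> v \<in> C} = (?r -` A \<inter> space P) \<inter> C"
        using sets.sets_into_space[OF C(1)] by auto
      then show "{v \<in> space P. ?r v \<in> A \<and> v \<in> C} \<in> sets P"
        using measurable_sets[OF restrict_measurable A] C(1) by simp
    qed
    also have "\<dots> = (\<integral>\<^sup>+D. emeasure (PD D) C * indicator A D \<partial>Q)"
      using realized A C(2) by (simp add: realized_world_def)
    also have "\<dots> = (\<integral>\<^sup>+D. emeasure (PD D) C \<partial>density Q (indicator A))"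
      using m AQ by (subst nn_integral_density) (simp_all add: mult.commute)
    also have "\<dots> = emeasure (bind (density Q (indicator A)) PD) C"
      by (rule emeasure_bind[OF ne PD C(2), symmetric])
    finally show "emeasure (density P (\<lambda>v. indicator A (?r v))) C =
        emeasure (bind (density Q (indicator A)) PD) C" .
  qed
  moreover have "(\<integral>\<^sup>+v. f v \<partial>density P (\<lambda>v. indicator A (?r v))) = (\<integral>\<^sup>+v. indicator A (?r v) * f v \<partial>P)"
    using f sP iA by (subst nn_integral_density) (simp_all cong: measurable_cong_sets)
  moreover have "(\<integral>\<^sup>+v. f v \<partial>bind (density Q (indicator A)) PD) =
      (\<integral>\<^sup>+D. (\<integral>\<^sup>+v. f v \<partial>PD D) * indicator A D \<partial>Q)"
    using nn_integral_bind[OF f PD] AQ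
      measurable_compose[OF measurable_prob_algebraD[OF PD_measurable] nn_integral_measurable_subprob_algebra[OF f]]
    by (subst (asm) nn_integral_density) (simp_all add: mult.commute)
  ultimately show ?thesis by simp
qed

text \<open>Both sides of the disintegration are kernels in the visible data \<open>D\<close>.
  Tested against \<open>A\<close> and \<open>C\<close> they turn into integrals under
  \<open>P\<close>, where \<open>visible_integral\<close> compares them.\<close>

lemma AE_conditional_kernel: "AE D in Q. conditional_kernel M (PD D) ys xs K"
proof -
  let ?R = "tspace (map val (xs @ ys))"
  let ?k = "\<lambda>D. tuple_law M (PD D) (xs @ ys)"
  let ?k' = "\<lambda>D. sprod (map val xs) (map val ys) (tuple_law M (PD D) xs) (kmap K)"
  have law: "(\<lambda>D. tuple_law M (PD D) is) \<in> Q \<rightarrow>\<^sub>M prob_algebra (tspace (map val is))"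
    if "set is \<subseteq> m_idx M" for "is"
    unfolding tuple_law_def
    by (rule measurable_compose[OF PD_measurable measurable_distr_prob_space[OF tpick_world[OF that refl]]])
  have K': "kmap K \<in> tspace (map val xs) \<rightarrow>\<^sub>M prob_algebra (tspace (map val ys))"
    using prob_kernelD(1)[OF K(1)] K by simp
  have "AE D in Q. ?k D = ?k' D"
  proof (rule AE_kernel_eq)
    show "countably_generated ?R"
    proof (rule countably_generated_tspace)
      fix A assume "A \<in> set (map val (xs @ ys))"
      then show "standard_borel A" using xs_ys_idx model by (auto simp: causal_model_def)
    qed
    have "prob_space Q" using prob_space.prob_space_distr[OF prob_P restrict_measurable] .
    then show "finite_measure Q" by (rule prob_space.finite_measure)
    show "?k \<in> Q \<rightarrow>\<^sub>M prob_algebra ?R" by (rule law[OF xs_ys_idx])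
    show "?k' \<in> Q \<rightarrow>\<^sub>M prob_algebra ?R"
      using measurable_bind_prob_space[OF law[OF xs(3)] sprod_kernel_measurable[OF K']]
      by (simp add: sprod_def)
    fix A C assume "A \<in> sets Q" and C: "C \<in> sets ?R"
    then have A: "A \<in> sets (PiM VV val)" by simp
    have C': "indicator C \<in> borel_measurable (tspace (map val xs @ map val ys))" using C by simp
    have eq: "emeasure (?k D) C = (\<integral>\<^sup>+v. indicator C (tpick (xs @ ys) v) \<partial>PD D)"
      "emeasure (?k' D) C = (\<integral>\<^sup>+v. \<kappa> C (tpick xs v) \<partial>PD D)" if D: "D \<in> space Q" for D
    proof -
      have s: "sets (PD D) = sets (world_space M)"
        using measurable_space[OF PD_measurable D] by (simp add: space_prob_algebra)
      have t: "tpick is \<in> PD D \<rightarrow>\<^sub>M tspace (map val is)" if "set is \<subseteq> m_idx M" for "is"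
        by (rule tpick_world[OF that s])
      have "emeasure (?k D) C = (\<integral>\<^sup>+u. indicator C u \<partial>?k D)"
        using C by (simp add: tuple_law_def)
      also have "\<dots> = (\<integral>\<^sup>+v. indicator C (tpick (xs @ ys) v) \<partial>PD D)"
        unfolding tuple_law_def using C by (intro nn_integral_distr[OF t[OF xs_ys_idx]]) simp
      finally show "emeasure (?k D) C = (\<integral>\<^sup>+v. indicator C (tpick (xs @ ys) v) \<partial>PD D)" .
      have law_xs: "sets (tuple_law M (PD D) xs) = sets (tspace (map val xs))"
        "prob_space (tuple_law M (PD D) xs)"
        using measurable_space[OF law[OF xs(3)] D] by (auto simp: space_prob_algebra)
      have "emeasure (?k' D) C = (\<integral>\<^sup>+u. indicator C u \<partial>?k' D)"
        using C sets_sprod(1)[OF law_xs K'] by simp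
      also have "\<dots> = (\<integral>\<^sup>+s. \<kappa> C s \<partial>tuple_law M (PD D) xs)"
        using nn_integral_sprod(1)[OF law_xs(1) K' C'] by (simp add: \<kappa>_def)
      also have "\<dots> = (\<integral>\<^sup>+v. \<kappa> C (tpick xs v) \<partial>PD D)"
        unfolding tuple_law_def using \<kappa>_measurable[OF C] by (intro nn_integral_distr[OF t[OF xs(3)]]) simp
      finally show "emeasure (?k' D) C = (\<integral>\<^sup>+v. \<kappa> C (tpick xs v) \<partial>PD D)" .
    qed
    have "(\<integral>\<^sup>+D. emeasure (?k D) C * indicator A D \<partial>Q) =
        (\<integral>\<^sup>+D. (\<integral>\<^sup>+v. indicator C (tpick (xs @ ys) v) \<partial>PD D) * indicator A D \<partial>Q)"
      by (rule nn_integral_cong) (simp only: eq)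
    also have "\<dots> = (\<integral>\<^sup>+v. indicator A (restrict v VV) * indicator C (tpick (xs @ ys) v) \<partial>P)"
      by (rule realized_integral[OF A, symmetric])
        (rule measurable_compose[OF tpick_world[OF xs_ys_idx refl] borel_measurable_indicator[OF C]])
    also have "\<dots> = (\<integral>\<^sup>+v. indicator A (restrict v VV) * \<kappa> C (tpick xs v) \<partial>P)"
      by (rule visible_integral[OF C A])
    also have "\<dots> = (\<integral>\<^sup>+D. (\<integral>\<^sup>+v. \<kappa> C (tpick xs v) \<partial>PD D) * indicator A D \<partial>Q)"
      by (rule realized_integral[OF A])
        (rule measurable_compose[OF tpick_world[OF xs(3) refl] \<kappa>_measurable[OF C]])
    also have "\<dots> = (\<integral>\<^sup>+D. emeasure (?k' D) C * indicator A D \<partial>Q)"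
      by (rule nn_integral_cong) (simp only: eq)
    finally show "(\<integral>\<^sup>+D. emeasure (?k D) C * indicator A D \<partial>Q) =
        (\<integral>\<^sup>+D. emeasure (?k' D) C * indicator A D \<partial>Q)" .
  qed
  then show ?thesis by eventually_elim (use K in \<open>simp add: conditional_kernel_def\<close>)
qed

section \<open>Identifiability of the candidate kernel\<close>

lemma K_identifiable:
  assumes "\<forall>(\<mu>, \<sigma>) \<in> set \<Gamma>. identifiable M P Ns W \<mu> \<sigma>"
    and "reg_value \<Gamma> F SK (tuple_law M P xs)"
  shows "identifiable M P Ns W K (tuple_law M P xs)"
  unfolding K_def
proof (rule identifiable_Regard[OF _ _ K_regardable])
  let ?\<rho> = "tuple_law M P xs"
  have sP: "sets P = sets (world_space M)" using sets_P by (simp add: world_space_def)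
  have \<rho>: "sets ?\<rho> = sets (tspace (map val xs))" "prob_space ?\<rho>"
    using prob_space.prob_space_distr[OF prob_P tpick_world[OF xs(3) sP]]
    by (auto simp: tuple_law_def)
  then show "prob_on (map val xs) ?\<rho>" by (simp add: prob_on_def)
  have dom: "sets (tspace (kdom SK)) = sets (tspace (map val xs))"
    unfolding SK(2) xs_def using os val_outer nth_mem[of _ os]
    by (intro tspace_cong) (simp add: list_all2_conv_all_nth del: nth_mem)
  \<comment> \<open>Passing from the model to the graph keeps the reference measure: the selection
    is the identity on tuples, and outer value spaces have the same measurable sets on both
    sides.\<close>
  have "distr ?\<rho> (tspace (kdom SK)) (tpick [0..<length xs]) = distr ?\<rho> ?\<rho> (\<lambda>s. s)"
    using tpick_upt_tspace[of _ "map val xs"] sets_eq_imp_space_eq[OF \<rho>(1)]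
    by (intro distr_cong) (simp_all add: dom \<rho>)
  then show "identifiable M P Ns W SK (distr ?\<rho> (tspace (kdom SK)) (tpick [0..<length xs]))"
    using identifiable_trans[OF assms] by (simp add: distr_id)
qed

end

theorem theorem2:
  fixes M :: "('i, 'g, 'v) model"
    and P :: "('i \<Rightarrow> 'v) measure"
    and \<Omega> :: "'w measure" and V :: "'i \<Rightarrow> 'w \<Rightarrow> 'v"
    and Ns :: "nat set" and W :: "nat \<Rightarrow> 'i set"
    and PD :: "('i \<Rightarrow> 'v) \<Rightarrow> ('i \<Rightarrow> 'v) measure"
    and G :: "('n, 'v) sgraph" and \<psi> :: "'n \<Rightarrow> 'i" and Y :: "'n set"
    and os ns :: "'n list"
    and F :: "'v regular_functional"
    and \<Gamma> :: "('v kernel \<times> (nat \<Rightarrow> 'v) measure) list"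
  assumes "causal_model M" and "acyclic (iedges M)" and "finite_past M"
    and "shallow_distribution M P" and "observable_world M P \<Omega> V"
    and "viewport M Ns W"
    and "realized_world M P (visible Ns W) PD"
    and "structured_query M (visible Ns W) G \<psi> Y"
    and "distinct os" and "set os = sg_outer G"
    and "causal_order (sg_edges G) (sg_inner G) ns"
    and "\<forall>(\<mu>, \<sigma>) \<in> set \<Gamma>. identifiable M P Ns W \<mu> \<sigma>"
    and "reg_value \<Gamma> F (structured_kernel G os ns (sg_inner G - Y))
           (tuple_law M P (map \<psi> os))"
  shows "query_identifiable M P Ns W \<Omega> V PD (underlying_query M G \<psi> Y)"
proof -
  interpret S: structured_setting M P Ns W PD G \<psi> Y os ns
    by unfold_locales (fact assms)+
  let ?V = "\<lambda>\<omega>. \<lambda>i\<in>m_idx M. V i \<omega>"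
  have V: "?V \<in> \<Omega> \<rightarrow>\<^sub>M world_space M" and P: "distr \<Omega> (world_space M) ?V = P"
    using assms(5) unfolding observable_world_def world_space_def
    by (auto intro: measurable_restrict)
  \<comment> \<open>The almost sure statement is pulled back twice, from the law of the visible data
    to \<open>P\<close> and from there to \<Omega>. The kernel \<open>S.K\<close> is fixed
    throughout and does not depend on the realization.\<close>
  have "AE v in P. conditional_kernel M (PD (restrict v (visible Ns W))) S.ys S.xs S.K"
    by (rule AE_distrD[OF S.restrict_measurable S.AE_conditional_kernel])
  then have "AE \<omega> in \<Omega>. conditional_kernel M (PD (restrict (?V \<omega>) (visible Ns W))) S.ys S.xs S.K"
    unfolding P[symmetric] by (rule AE_distrD[OF V])
  moreover have "restrict (?V \<omega>) (visible Ns W) = (\<lambda>i\<in>visible Ns W. V i \<omega>)" for \<omega>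
    using S.visible_idx by (auto simp: fun_eq_iff)
  ultimately have AE: "AE \<omega> in \<Omega>.
      conditional_kernel M (PD (\<lambda>i\<in>visible Ns W. V i \<omega>)) S.ys S.xs S.K"
    by simp
  have "identifiable M P Ns W S.K (tuple_law M P S.xs)"
    by (rule S.K_identifiable[OF assms(12)]) (use assms(13) in \<open>simp add: S.xs_def\<close>)
  moreover have "\<psi> ` Y \<inter> \<psi> ` sg_outer G = {}"
    using S.inj S.disj S.Y_inner by (auto simp: inj_on_def)
  then have "basic_query M (underlying_query M G \<psi> Y)"
    using S.ys(2,3) S.xs(2,3) S.fin_outer finite_subset[OF S.Y_inner S.fin_inner]
    by (auto simp: basic_query_def underlying_query_def)
  ultimately show ?thesis
    using S.ys(1,2) S.xs(1,2) AE
    unfolding query_identifiable_def underlying_query_def by auto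
qed

end
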